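(* Let $T>0$, $K>0$, let $\mu\in\mathfrak m_T$ and let $\nu$ be the associated integrated signed measure on $[0,T]\times[-1,0]$. For every $f\in L_1(\nu)$, $$\int_0^T\int_{[-1,0]}f(\tau,s)\,d\mu_\tau(s)\,d\tau=\int_{[0,T]\times[-1,0]}f(\tau,s)\,d\nu(\tau,s).$$
   Context: Let $\mathfrak m$ be the set of finite signed Borel measures on $[-1,0]$ with total variation norm at most $K$. $\mathfrak m_T$ is the set of all maps $\mu:[0,T]\to\mathfrak m$, $t\mapsto\mu_t$, such that for every $g\in C([-1,0])$ the function $t\mapsto\int_{[-1,0]}g\,d\mu_t$ is Lebesgue measurable on $[0,T]$. For a Borel set $A\subset[0,T]\times[-1,0]$ write $A_\tau=\{s\in[-1,0]:(\tau,s)\in A\}$. The integrated measure is $\nu(A)=\int_0^T\mu_\tau(A_\tau)\,d\tau$ for Borel $A\subset[0,T]\times[-1,0]$; the integrand is bounded and Lebesgue measurable and $\nu$ is a finite signed Borel measure. $L_1(\nu)$ consists of (classes of) Borel functions $f:[0,T]\times[-1,0]\to\mathbb R$ with $\int|f|\,d|\nu|<\infty$, identified when equal $|\nu|$-a.e. The iterated integral is understood with the inner integral existing for Lebesgue-almost every $\tau$. *)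

theory Defs
  imports "HOL-Analysis.Analysis"
begin

text \<open>A finite signed measure is a real-valued countably additive set function. As with
  \<open>measure_of\<close>, only \<open>space M\<close> and \<open>sets M\<close> of the argument \<open>M\<close> matter below, and the values of
  a set function outside \<open>sets M\<close> are irrelevant.\<close>

definition signed_measure :: "'a measure \<Rightarrow> ('a set \<Rightarrow> real) \<Rightarrow> bool" where
  "signed_measure M m \<longleftrightarrow> m {} = 0 \<and>
     (\<forall>E :: nat \<Rightarrow> 'a set. range E \<subseteq> sets M \<longrightarrow> disjoint_family E \<longrightarrow>
        (\<lambda>i. m (E i)) sums m (\<Union>i. E i))"

definition variation :: "'a measure \<Rightarrow> ('a set \<Rightarrow> real) \<Rightarrow> 'a set \<Rightarrow> ennreal" where
  "variation M m A =
     (SUP E \<in> {E :: nat \<Rightarrow> 'a set. range E \<subseteq> sets M \<and> disjoint_family E \<and> (\<Union>i. E i) = A}.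
        \<Sum>i. ennreal \<bar>m (E i)\<bar>)"

definition variation_measure :: "'a measure \<Rightarrow> ('a set \<Rightarrow> real) \<Rightarrow> 'a measure" where
  "variation_measure M m = measure_of (space M) (sets M) (variation M m)"

text \<open>Jordan decomposition, with positive and negative parts \<open>(\<bar>m\<bar> + m) / 2\<close> and
  \<open>(\<bar>m\<bar> - m) / 2\<close>. The conversion \<open>enn2real\<close> loses nothing, since the variation of a
  real-valued signed measure is finite.\<close>

definition positive_part :: "'a measure \<Rightarrow> ('a set \<Rightarrow> real) \<Rightarrow> 'a measure" where
  "positive_part M m = measure_of (space M) (sets M)
     (\<lambda>A. ennreal ((enn2real (variation M m A) + m A) / 2))"

definition negative_part :: "'a measure \<Rightarrow> ('a set \<Rightarrow> real) \<Rightarrow> 'a measure" where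
  "negative_part M m = measure_of (space M) (sets M)
     (\<lambda>A. ennreal ((enn2real (variation M m A) - m A) / 2))"

definition signed_integrable :: "'a measure \<Rightarrow> ('a set \<Rightarrow> real) \<Rightarrow> ('a \<Rightarrow> real) \<Rightarrow> bool" where
  "signed_integrable M m f \<longleftrightarrow> integrable (variation_measure M m) f"

definition signed_integral :: "'a measure \<Rightarrow> ('a set \<Rightarrow> real) \<Rightarrow> ('a \<Rightarrow> real) \<Rightarrow> real" where
  "signed_integral M m f =
     integral\<^sup>L (positive_part M m) f - integral\<^sup>L (negative_part M m) f"

abbreviation delay_borel :: "real measure" where
  "delay_borel \<equiv> restrict_space borel {-1..0}"

abbreviation rect_borel :: "real \<Rightarrow> (real \<times> real) measure" where
  "rect_borel T \<equiv> restrict_space borel ({0..T} \<times> {-1..0})"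

definition delay_measures :: "real \<Rightarrow> (real set \<Rightarrow> real) set" where
  "delay_measures K =
     {m. signed_measure delay_borel m \<and> variation delay_borel m {-1..0} \<le> ennreal K}"

definition delay_measure_maps :: "real \<Rightarrow> real \<Rightarrow> (real \<Rightarrow> real set \<Rightarrow> real) set" where
  "delay_measure_maps T K =
     {\<mu> \<in> {0..T} \<rightarrow> delay_measures K.
        \<forall>g. continuous_on {-1..0} g \<longrightarrow>
          (\<lambda>t. signed_integral delay_borel (\<mu> t) g) \<in> borel_measurable (lebesgue_on {0..T})}"

definition integrated_measure ::
    "real \<Rightarrow> (real \<Rightarrow> real set \<Rightarrow> real) \<Rightarrow> (real \<times> real) set \<Rightarrow> real" where
  "integrated_measure T \<mu> A =
     integral\<^sup>L (lebesgue_on {0..T}) (\<lambda>\<tau>. \<mu> \<tau> {s \<in> {-1..0}. (\<tau>, s) \<in> A})"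

end

theory Submission
  imports Defs
begin

text \<open>The Jordan parts are what makes the identity more than a routine Fubini theorem: the signed integral
against \<open>\<nu>\<close> refers to the variation of \<open>\<nu>\<close>, the inner integrals to the variations of the
\<open>\<mu> \<tau>\<close>, and nothing in the hypotheses says that these vary measurably with \<open>\<tau>\<close> or that
they fit together.

Both points are settled by one Hahn set \<open>P\<close> of \<open>\<nu>\<close>. For Borel sets \<open>E\<close> of times and \<open>B\<close> of
delays, \<open>\<nu> (P \<inter> (E \<times> B)) \<ge> 0\<close> says that \<open>\<mu> \<tau> (P\<^sub>\<tau> \<inter> B)\<close> has a nonnegative integral over \<open>E\<close>;
hence it is nonnegative for almost every \<open>\<tau>\<close>. Taking \<open>B\<close> from a countable family of open sets and
using regularity, one null set of times can be chosen for all \<open>B\<close> (\<open>AE_slice_positive_set\<close>). So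
for almost every \<open>\<tau>\<close> the slice \<open>P\<^sub>\<tau>\<close> is a Hahn set of \<open>\<mu> \<tau>\<close> (\<open>AE_hahn_set_slice\<close>).

It follows that \<open>\<bar>\<nu>\<bar>\<close> is the mixture of the \<open>\<bar>\<mu> \<tau>\<bar>\<close>. The theorem for mixtures of positive measures
(\<open>integral_mixture\<close>), applied to \<open>f\<close>, gives the integrability of almost every slice; applied
to \<open>f\<close> with its sign reversed off \<open>P\<close> it gives the identity, because that sign is the polar
density of \<open>\<nu>\<close> and, slice by slice, of \<open>\<mu> \<tau>\<close> (\<open>signed_integral_eq\<close>).

It remains to see that \<open>\<tau> \<mapsto> \<mu> \<tau> (A\<^sub>\<tau>)\<close> is measurable for Borel sets \<open>A\<close>, so that \<open>\<nu>\<close> is a signed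
measure at all. This is a monotone approximation of half-lines by continuous functions followed by
Dynkin's theorem (\<open>bounded_signed_kernel_if_delay_measure_map\<close>).\<close>

section \<open>Bounded signed measures and the Hahn decomposition\<close>

lemma disjoint_family_binaryset: "A \<inter> B = {} \<Longrightarrow> disjoint_family (binaryset A B)"
  by (auto simp: disjoint_family_on_def binaryset_def)

lemma emeasure_measure_of_sums:
  fixes M :: "'a measure" and r :: "'a set \<Rightarrow> real"
  assumes "\<And>A. A \<in> sets M \<Longrightarrow> \<phi> A = ennreal (r A)" "\<And>A. A \<in> sets M \<Longrightarrow> 0 \<le> r A" "r {} = 0"
    and "\<And>E :: nat \<Rightarrow> _. (\<And>i. E i \<in> sets M) \<Longrightarrow> disjoint_family E \<Longrightarrow> (\<lambda>i. r (E i)) sums r (\<Union>i. E i)"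
    and A: "A \<in> sets M"
  shows "emeasure (measure_of (space M) (sets M) \<phi>) A = ennreal (r A)"
proof -
  have "measure_of (space M) (sets M) \<phi> = measure_of (space M) (sets M) (\<lambda>A. ennreal (r A))"
    using assms(1) by (intro measure_of_eq sets.space_closed) (simp add: sets.sigma_sets_eq)
  moreover have "emeasure (measure_of (space M) (sets M) (\<lambda>A. ennreal (r A))) A = ennreal (r A)"
  proof (rule emeasure_measure_of_sigma[OF sets.sigma_algebra_axioms _ _ A])
    show "positive (sets M) (\<lambda>A. ennreal (r A))"
      using assms(3) by (simp add: positive_def)
    show "countably_additive (sets M) (\<lambda>A. ennreal (r A))"
    proof (rule countably_additiveI)
      fix E :: "nat \<Rightarrow> _" assume E: "range E \<subseteq> sets M" "disjoint_family E"
      then show "(\<Sum>i. ennreal (r (E i))) = ennreal (r (\<Union>i. E i))"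
        using assms(2,4) by (intro suminf_ennreal_eq) auto
    qed
  qed
  ultimately show ?thesis by simp
qed

text \<open>The bound \<open>C\<close> is carried along because it becomes the dominating constant when a family of signed
measures is integrated over a parameter.\<close>

locale bounded_signed_measure =
  fixes M :: "'a measure" and m :: "'a set \<Rightarrow> real" and C :: real
  assumes signed_measure: "signed_measure M m"
    and bounded: "A \<in> sets M \<Longrightarrow> \<bar>m A\<bar> \<le> C"

definition hahn_set :: "'a measure \<Rightarrow> ('a set \<Rightarrow> real) \<Rightarrow> 'a set \<Rightarrow> bool" where
  "hahn_set M m P \<longleftrightarrow> P \<in> sets M \<and> (\<forall>A\<in>sets M. A \<subseteq> P \<longrightarrow> 0 \<le> m A) \<and>
     (\<forall>A\<in>sets M. A \<inter> P = {} \<longrightarrow> m A \<le> 0)"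

context bounded_signed_measure
begin

lemma empty: "m {} = 0"
  using signed_measure by (simp add: signed_measure_def)

lemma sums_UN:
  fixes E :: "nat \<Rightarrow> 'a set"
  assumes "\<And>i. E i \<in> sets M" "disjoint_family E"
  shows "(\<lambda>i. m (E i)) sums m (\<Union>i. E i)"
  using signed_measure assms unfolding signed_measure_def by blast

lemma Un_disjoint:
  assumes "A \<in> sets M" "B \<in> sets M" "A \<inter> B = {}"
  shows "m (A \<union> B) = m A + m B"
proof -
  have "(\<lambda>i. m (binaryset A B i)) sums m (\<Union>i. binaryset A B i)"
    using assms by (intro sums_UN disjoint_family_binaryset) (auto simp: binaryset_def)
  moreover have "(\<lambda>i. m (binaryset A B i)) sums (m A + m B)"
    using binaryset_sums[of m A B] empty by simp
  ultimately show ?thesis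
    unfolding UN_binaryset_eq by (rule sums_unique2)
qed

lemma Int_Diff:
  assumes "A \<in> sets M" "B \<in> sets M"
  shows "m A = m (A \<inter> B) + m (A - B)"
  using Un_disjoint[of "A \<inter> B" "A - B"] assms by (simp add: Int_Diff_Un Int_Diff_disjoint)

lemma Diff_subset:
  assumes "A \<in> sets M" "B \<in> sets M" "B \<subseteq> A"
  shows "m (A - B) = m A - m B"
  using Int_Diff[of A B] assms by (simp add: Int_absorb1)

lemma modular:
  assumes "A \<in> sets M" "B \<in> sets M"
  shows "m (A \<union> B) + m (A \<inter> B) = m A + m B"
proof -
  have "m (A \<union> B) = m (A - B) + m B"
    using Un_disjoint[of "A - B" B] assms by (simp add: Un_Diff_cancel2 Int_commute[of "A - B" B])
  then show ?thesis using Int_Diff[OF assms] by simp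
qed

lemma tendsto_incseq:
  assumes "\<And>i. E i \<in> sets M" "incseq E"
  shows "(\<lambda>n. m (E n)) \<longlonglongrightarrow> m (\<Union>i. E i)"
proof -
  have D: "disjointed E i \<in> sets M" for i
    using assms(1) sets.range_disjointed_sets[of E M] by blast
  have *: "(\<Sum>i<Suc n. m (disjointed E i)) = m (E n)" for n
  proof (induction n)
    case 0
    then show ?case by (simp add: disjointed_def)
  next
    case (Suc n)
    have "disjointed E (Suc n) = E (Suc n) - E n"
      using disjointed_mono[OF assms(2)] by simp
    then have "m (disjointed E (Suc n)) = m (E (Suc n)) - m (E n)"
      using assms by (simp add: Diff_subset incseq_SucD)
    with Suc show ?case by simp
  qed
  have "(\<lambda>n. \<Sum>i<n. m (disjointed E i)) \<longlonglongrightarrow> m (\<Union>i. disjointed E i)"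
    using sums_UN[OF D disjoint_family_disjointed] by (simp add: sums_def)
  then have "(\<lambda>n. \<Sum>i<Suc n. m (disjointed E i)) \<longlonglongrightarrow> m (\<Union>i. disjointed E i)"
    by (rule LIMSEQ_Suc)
  then show ?thesis unfolding * UN_disjointed_eq .
qed

lemma tendsto_decseq:
  assumes E: "\<And>i. E i \<in> sets M" "decseq E"
  shows "(\<lambda>n. m (E n)) \<longlonglongrightarrow> m (\<Inter>i. E i)"
proof -
  have I: "(\<Inter>i. E i) \<in> sets M" using E by auto
  have "(\<lambda>n. m (E 0 - E n)) \<longlonglongrightarrow> m (\<Union>n. E 0 - E n)"
    using E by (intro tendsto_incseq) (auto simp: incseq_def decseq_def)
  also have "(\<Union>n. E 0 - E n) = E 0 - (\<Inter>i. E i)" by auto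
  also have "m \<dots> = m (E 0) - m (\<Inter>i. E i)"
    using E I by (intro Diff_subset) auto
  also have "(\<lambda>n. m (E 0 - E n)) = (\<lambda>n. m (E 0) - m (E n))"
    using E by (intro ext Diff_subset) (auto simp: decseq_def)
  finally have "(\<lambda>n. m (E 0) - m (E n)) \<longlonglongrightarrow> m (E 0) - m (\<Inter>i. E i)" .
  from tendsto_diff[OF tendsto_const this, of "m (E 0)"] show ?thesis by simp
qed

text \<open>A set of maximal measure is a positive set with negative complement. A maximiser is the limes inferior
of sets \<open>A n\<close> with \<open>m (A n) > s - (1/2)^n\<close>, where \<open>s\<close> is the supremum: by modularity
an intersection loses at most the sum of the defects of the intersected sets, and these defects are
summable.\<close>

lemma hahn_set_exists: "\<exists>P. hahn_set M m P"
proof -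
  define s where "s = (SUP A\<in>sets M. m A)"
  have bdd: "bdd_above (m ` sets M)"
    using bounded by (intro bdd_aboveI2[where M=C]) (metis abs_le_D1)
  have le_s: "m A \<le> s" if "A \<in> sets M" for A
    unfolding s_def using that bdd by (rule cSUP_upper)
  have "\<exists>A\<in>sets M. s - (1/2)^n < m A" for n :: nat
  proof -
    have "s - (1/2)^n < (SUP A\<in>sets M. m A)" by (simp add: s_def)
    then show ?thesis
      using bdd by (subst (asm) less_cSUP_iff) auto
  qed
  then obtain A where A: "\<And>n::nat. A n \<in> sets M" "\<And>n. s - (1/2)^n < m (A n)"
    by metis
  define B where "B n k = (\<Inter>i\<in>{n..n+k}. A i)" for n k
  have B: "B n k \<in> sets M" for n k
    unfolding B_def using A(1) by (intro sets.finite_INT) auto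
  \<comment> \<open>The amount subtracted from \<open>s\<close> is the sum of the defects \<open>(1/2)^i\<close> for \<open>i\<in>{n..n+k}\<close>.\<close>
  have B_lower: "s - 2 * (1/2)^n + (1/2)^(n+k) \<le> m (B n k)" for n k
  proof (induction k)
    case 0
    then show ?case using A(2)[of n] by (simp add: B_def)
  next
    case (Suc k)
    have eq: "B n (Suc k) = B n k \<inter> A (n + Suc k)"
      unfolding B_def by (auto simp: atLeastAtMostSuc_conv)
    have "m (B n k \<union> A (n + Suc k)) \<le> s"
      using B A by (intro le_s) auto
    moreover have "(1/2::real)^(n + Suc k) = (1/2)^(n + k) / 2" by simp
    ultimately show ?case
      using modular[OF B A(1), of n k "n + Suc k"] A(2)[of "n + Suc k"] Suc
      unfolding eq by linarith
  qed
  define D where "D n = (\<Inter>k. B n k)" for n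
  have D: "D n \<in> sets M" for n unfolding D_def using B by auto
  have D_lower: "s - 2 * (1/2)^n \<le> m (D n)" for n
  proof (rule LIMSEQ_le_const)
    show "(\<lambda>k. m (B n k)) \<longlonglongrightarrow> m (D n)"
      unfolding D_def using B
      by (intro tendsto_decseq) (auto simp: decseq_def B_def)
    have "s - 2 * (1/2)^n \<le> m (B n k)" for k
    proof -
      have "(0::real) \<le> (1/2)^(n+k)" by simp
      with B_lower[of n k] show ?thesis by linarith
    qed
    then show "\<exists>N. \<forall>k\<ge>N. s - 2 * (1/2)^n \<le> m (B n k)" by blast
  qed
  define P where "P = (\<Union>n. D n)"
  have P: "P \<in> sets M" unfolding P_def using D by auto
  have "s - 2 * 0 \<le> m P"
  proof (rule LIMSEQ_le)
    show "(\<lambda>n. s - 2 * (1/2)^n) \<longlonglongrightarrow> s - 2 * 0"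
      by (intro tendsto_intros LIMSEQ_power_zero) auto
    show "(\<lambda>n. m (D n)) \<longlonglongrightarrow> m P"
      unfolding P_def using D
    proof (intro tendsto_incseq)
      have "D n \<subseteq> D (Suc n)" for n
      proof
        fix x assume x: "x \<in> D n"
        have "x \<in> A i" if "n \<le> i" for i
        proof -
          have "x \<in> B n (i - n)" using x by (simp add: D_def)
          with that show ?thesis by (simp add: B_def)
        qed
        then show "x \<in> D (Suc n)" by (simp add: D_def B_def)
      qed
      then show "incseq D" by (rule incseq_SucI)
    qed
    show "\<exists>N. \<forall>n\<ge>N. s - 2 * (1/2)^n \<le> m (D n)" using D_lower by blast
  qed
  then have P_max: "s \<le> m P" by simp
  have "hahn_set M m P"
    unfolding hahn_set_def
  proof (intro conjI ballI impI P)
    fix A assume "A \<in> sets M" "A \<subseteq> P"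
    with P have "m (P - A) = m P - m A" "m (P - A) \<le> s"
      by (auto intro: Diff_subset le_s)
    with P_max show "0 \<le> m A" by simp
  next
    fix A assume "A \<in> sets M" "A \<inter> P = {}"
    with P have "m (A \<union> P) = m A + m P" "m (A \<union> P) \<le> s"
      by (auto intro: Un_disjoint le_s)
    with P_max show "m A \<le> 0" by simp
  qed
  then show ?thesis ..
qed

end

text \<open>A fixed Hahn set \<open>P\<close> turns the supremum that defines the variation, and with it the Jordan parts,
into explicit values of \<open>m\<close>. The results below therefore hold for every choice of \<open>P\<close>;
this freedom is what allows a Hahn set of the integrated measure to be reused for the single measures.\<close>

locale hahn_decomposition = bounded_signed_measure +
  fixes P
  assumes hahn: "hahn_set M m P"
begin

definition pos :: "'a set \<Rightarrow> real" where "pos A = m (A \<inter> P)"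
definition neg :: "'a set \<Rightarrow> real" where "neg A = - m (A - P)"

lemma P [measurable]: "P \<in> sets M"
  using hahn by (simp add: hahn_set_def)

lemma pos_nonneg: "A \<in> sets M \<Longrightarrow> 0 \<le> pos A"
  and neg_nonneg: "A \<in> sets M \<Longrightarrow> 0 \<le> neg A"
proof -
  assume A: "A \<in> sets M"
  show "0 \<le> pos A" using hahn P A by (simp add: hahn_set_def pos_def)
  have "(A - P) \<inter> P = {}" by auto
  then show "0 \<le> neg A" using hahn P A by (simp add: hahn_set_def neg_def)
qed

lemma eq_pos_minus_neg: "A \<in> sets M \<Longrightarrow> m A = pos A - neg A"
  using Int_Diff[of A P] P by (simp add: pos_def neg_def)

lemma pos_sums:
  assumes "\<And>i. E i \<in> sets M" "disjoint_family E"
  shows "(\<lambda>i. pos (E i)) sums pos (\<Union>i. E i)"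
proof -
  have "(\<lambda>i. m (E i \<inter> P)) sums m (\<Union>i. E i \<inter> P)"
    using assms P by (intro sums_UN) (auto simp: disjoint_family_on_def)
  also have "(\<Union>i. E i \<inter> P) = (\<Union>i. E i) \<inter> P" by auto
  finally show ?thesis by (simp add: pos_def)
qed

lemma neg_sums:
  assumes "\<And>i. E i \<in> sets M" "disjoint_family E"
  shows "(\<lambda>i. neg (E i)) sums neg (\<Union>i. E i)"
proof -
  have "(\<lambda>i. - m (E i - P)) sums - m (\<Union>i. E i - P)"
    using assms P by (intro sums_minus sums_UN) (auto simp: disjoint_family_on_def)
  also have "(\<Union>i. E i - P) = (\<Union>i. E i) - P" by auto
  finally show ?thesis by (simp add: neg_def)
qed

lemma abs_le: "A \<in> sets M \<Longrightarrow> \<bar>m A\<bar> \<le> pos A + neg A"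
  using pos_nonneg[of A] neg_nonneg[of A] eq_pos_minus_neg[of A] by linarith

text \<open>No partition of \<open>A\<close> gives more than \<open>pos A + neg A\<close>, since \<open>\<bar>m\<bar> \<le> pos + neg\<close> and the right-hand
side is additive; the partition of \<open>A\<close> by \<open>P\<close> attains this value.\<close>

lemma variation_eq:
  assumes A: "A \<in> sets M"
  shows "variation M m A = ennreal (pos A + neg A)"
  unfolding variation_def
proof (rule antisym)
  show "(SUP E \<in> {E :: nat \<Rightarrow> 'a set. range E \<subseteq> sets M \<and> disjoint_family E \<and> (\<Union>i. E i) = A}.
        \<Sum>i. ennreal \<bar>m (E i)\<bar>) \<le> ennreal (pos A + neg A)"
  proof (rule SUP_least)
    fix E :: "nat \<Rightarrow> 'a set"
    assume "E \<in> {E. range E \<subseteq> sets M \<and> disjoint_family E \<and> (\<Union>i. E i) = A}"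
    then have E: "\<And>i. E i \<in> sets M" "disjoint_family E" and un: "(\<Union>i. E i) = A" by auto
    have s: "(\<lambda>i. pos (E i) + neg (E i)) sums (pos A + neg A)"
      using sums_add[OF pos_sums[OF E] neg_sums[OF E]] by (simp add: un)
    have "(\<Sum>i. ennreal \<bar>m (E i)\<bar>) \<le> (\<Sum>i. ennreal (pos (E i) + neg (E i)))"
      using abs_le E by (intro suminf_le ennreal_leI) auto
    also have "\<dots> = ennreal (pos A + neg A)"
      using s E pos_nonneg neg_nonneg
      by (intro suminf_ennreal_eq) auto
    finally show "(\<Sum>i. ennreal \<bar>m (E i)\<bar>) \<le> ennreal (pos A + neg A)" .
  qed
  let ?E = "binaryset (A \<inter> P) (A - P)"
  have "ennreal (pos A + neg A) = ennreal \<bar>m (A \<inter> P)\<bar> + ennreal \<bar>m (A - P)\<bar>"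
    using pos_nonneg[OF A] neg_nonneg[OF A]
    by (simp add: pos_def neg_def ennreal_plus flip: ennreal_plus)
  also have "\<dots> = (\<Sum>i. ennreal \<bar>m (?E i)\<bar>)"
    by (rule suminf_binaryset_eq[symmetric]) (simp add: empty)
  also have "\<dots> \<le> (SUP E \<in> {E :: nat \<Rightarrow> 'a set. range E \<subseteq> sets M \<and> disjoint_family E \<and> (\<Union>i. E i) = A}.
        \<Sum>i. ennreal \<bar>m (E i)\<bar>)"
  proof (rule SUP_upper)
    show "?E \<in> {E. range E \<subseteq> sets M \<and> disjoint_family E \<and> (\<Union>i. E i) = A}"
    proof (intro CollectI conjI)
      show "range ?E \<subseteq> sets M" using A by (auto simp: range_binaryset_eq)
      show "disjoint_family ?E" by (rule disjoint_family_binaryset) auto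
      show "(\<Union>i. ?E i) = A" by (auto simp: UN_binaryset_eq)
    qed
  qed
  finally show "ennreal (pos A + neg A) \<le> (SUP E \<in> {E :: nat \<Rightarrow> 'a set. range E \<subseteq> sets M \<and> disjoint_family E \<and> (\<Union>i. E i) = A}.
        \<Sum>i. ennreal \<bar>m (E i)\<bar>)" .
qed

lemma sets_variation_measure [measurable_cong, simp]: "sets (variation_measure M m) = sets M"
  and space_variation_measure [simp]: "space (variation_measure M m) = space M"
  by (simp_all add: variation_measure_def)

lemma emeasure_variation_measure:
  assumes A: "A \<in> sets M"
  shows "emeasure (variation_measure M m) A = ennreal (m (A \<inter> P) - m (A - P))"
proof -
  have "emeasure (variation_measure M m) A = ennreal (pos A + neg A)"
    unfolding variation_measure_def
  proof (rule emeasure_measure_of_sums[where r="\<lambda>A. pos A + neg A", OF variation_eq _ _ _ A])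
    show "0 \<le> pos B + neg B" if "B \<in> sets M" for B
      using pos_nonneg[OF that] neg_nonneg[OF that] by simp
    show "pos {} + neg {} = 0" by (simp add: pos_def neg_def empty)
    show "(\<lambda>i. pos (E i) + neg (E i)) sums (pos (\<Union>i. E i) + neg (\<Union>i. E i))"
      if "\<And>i. E i \<in> sets M" "disjoint_family E" for E :: "nat \<Rightarrow> _"
      using that by (intro sums_add pos_sums neg_sums)
  qed
  then show ?thesis by (simp add: pos_def neg_def)
qed

lemma finite_variation_measure: "finite_measure (variation_measure M m)"
  by standard (simp add: emeasure_variation_measure)

lemma emeasure_positive_part:
  assumes A: "A \<in> sets M"
  shows "emeasure (positive_part M m) A = ennreal (m (A \<inter> P))"
proof -
  have *: "ennreal ((enn2real (variation M m B) + m B) / 2) = ennreal (pos B)" if "B \<in> sets M" for B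
    unfolding variation_eq[OF that] eq_pos_minus_neg[OF that]
    using pos_nonneg[OF that] neg_nonneg[OF that] by (subst enn2real_ennreal) simp_all
  have "emeasure (positive_part M m) A = ennreal (pos A)"
    unfolding positive_part_def
    by (rule emeasure_measure_of_sums[where r=pos, OF * pos_nonneg _ pos_sums A])
      (simp_all add: pos_def empty)
  then show ?thesis by (simp add: pos_def)
qed

lemma emeasure_negative_part:
  assumes A: "A \<in> sets M"
  shows "emeasure (negative_part M m) A = ennreal (- m (A - P))"
proof -
  have *: "ennreal ((enn2real (variation M m B) - m B) / 2) = ennreal (neg B)" if "B \<in> sets M" for B
    unfolding variation_eq[OF that] eq_pos_minus_neg[OF that]
    using pos_nonneg[OF that] neg_nonneg[OF that] by (subst enn2real_ennreal) simp_all
  have "emeasure (negative_part M m) A = ennreal (neg A)"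
    unfolding negative_part_def
    by (rule emeasure_measure_of_sums[where r=neg, OF * neg_nonneg _ neg_sums A])
      (simp_all add: neg_def empty)
  then show ?thesis by (simp add: neg_def)
qed

lemma positive_part_eq_density:
  "positive_part M m = density (variation_measure M m) (indicator P)"
proof (rule measure_eqI)
  show "sets (positive_part M m) = sets (density (variation_measure M m) (indicator P))"
    by (simp add: positive_part_def)
  fix A assume "A \<in> sets (positive_part M m)"
  then have A: "A \<in> sets M" by (simp add: positive_part_def)
  have eq: "P \<inter> A \<inter> P = A \<inter> P" "P \<inter> A - P = {}" by auto
  from A show "emeasure (positive_part M m) A
      = emeasure (density (variation_measure M m) (indicator P)) A"
    by (subst emeasure_restricted)
      (simp_all only: sets_variation_measure P emeasure_positive_part emeasure_variation_measure
        sets.Int eq empty diff_zero)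
qed

lemma negative_part_eq_density:
  "negative_part M m = density (variation_measure M m) (indicator (space M - P))"
proof (rule measure_eqI)
  show "sets (negative_part M m) = sets (density (variation_measure M m) (indicator (space M - P)))"
    by (simp add: negative_part_def)
  fix A assume "A \<in> sets (negative_part M m)"
  then have A: "A \<in> sets M" by (simp add: negative_part_def)
  have "(space M - P) \<inter> A \<inter> P = {}" "(space M - P) \<inter> A - P = A - P"
    using sets.sets_into_space[OF A] by auto
  with A show "emeasure (negative_part M m) A
      = emeasure (density (variation_measure M m) (indicator (space M - P))) A"
    by (simp add: emeasure_restricted emeasure_negative_part emeasure_variation_measure empty)
qed

text \<open>Signed integration is integration against the total variation of \<open>f\<close> times the sign of the density
\<open>dm/d\<bar>m\<bar>\<close>, which is \<open>1\<close> on \<open>P\<close> and \<open>-1\<close> off \<open>P\<close>. A statement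
about signed integrals thus becomes one about a single positive measure.\<close>

lemma signed_integral_eq:
  assumes "signed_integrable M m f"
  shows "signed_integral M m f = (\<integral>x. (if x \<in> P then f x else - f x) \<partial>variation_measure M m)"
proof -
  have f: "integrable (variation_measure M m) f"
    using assms by (simp add: signed_integrable_def)
  then have [measurable]: "f \<in> borel_measurable (variation_measure M m)"
    by (rule borel_measurable_integrable)
  have i: "integrable (variation_measure M m) (\<lambda>x. indicator A x * f x)" if "A \<in> sets M" for A
    using integrable_real_mult_indicator[of A "variation_measure M m" f] that f
    by (simp add: mult.commute)
  have dens: "integral\<^sup>L (density (variation_measure M m) (indicator A)) f
      = (\<integral>x. indicator A x * f x \<partial>variation_measure M m)" if "A \<in> sets M" for A
  proof -
    have [measurable]: "A \<in> sets (variation_measure M m)" using that by simp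
    have "(indicator A :: 'a \<Rightarrow> ennreal) = (\<lambda>x. ennreal (indicator A x))"
      by (simp add: fun_eq_iff ennreal_indicator)
    then show ?thesis by (simp only:) (subst integral_density, auto)
  qed
  note pos = dens[OF P, folded positive_part_eq_density]
  have neg: "integral\<^sup>L (negative_part M m) f
      = (\<integral>x. indicator (space M - P) x * f x \<partial>variation_measure M m)"
    unfolding negative_part_eq_density by (rule dens) auto
  have "signed_integral M m f
      = (\<integral>x. indicator P x * f x - indicator (space M - P) x * f x \<partial>variation_measure M m)"
    unfolding signed_integral_def pos neg using i by (subst Bochner_Integration.integral_diff) auto
  also have "\<dots> = (\<integral>x. (if x \<in> P then f x else - f x) \<partial>variation_measure M m)"
    by (intro Bochner_Integration.integral_cong refl) (auto simp: indicator_def)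
  finally show ?thesis .
qed

lemma signed_integral_indicator:
  assumes A: "A \<in> sets M"
  shows "signed_integral M m (indicator A) = m A"
proof -
  have sets: "sets (positive_part M m) = sets M" "sets (negative_part M m) = sets M"
    and space: "space (positive_part M m) = space M" "space (negative_part M m) = space M"
    by (simp_all add: positive_part_def negative_part_def)
  have "measure (positive_part M m) A = pos A" "measure (negative_part M m) A = neg A"
    using A pos_nonneg[OF A] neg_nonneg[OF A]
    by (simp_all add: measure_def emeasure_positive_part emeasure_negative_part pos_def neg_def)
  with A sets.sets_into_space[OF A] show ?thesis
    by (simp add: signed_integral_def sets space eq_pos_minus_neg Int_absorb2)
qed

end

lemma (in bounded_signed_measure) signed_integral_tendsto:
  assumes u: "\<And>n. u n \<in> borel_measurable M" and v: "v \<in> borel_measurable M"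
    and bound: "\<And>n x. x \<in> space M \<Longrightarrow> \<bar>u n x\<bar> \<le> B"
    and lim: "\<And>x. x \<in> space M \<Longrightarrow> (\<lambda>n. u n x) \<longlonglongrightarrow> v x"
  shows "(\<lambda>n. signed_integral M m (u n)) \<longlonglongrightarrow> signed_integral M m v"
proof -
  obtain P where "hahn_set M m P" using hahn_set_exists ..
  then interpret hahn_decomposition M m C P by unfold_locales
  have tendsto: "(\<lambda>n. integral\<^sup>L N (u n)) \<longlonglongrightarrow> integral\<^sup>L N v"
    if sets: "sets N = sets M" and fin: "emeasure N (space M) < \<infinity>" for N
  proof (rule integral_dominated_convergence[where w="\<lambda>_. B"])
    have space: "space N = space M" using sets by (rule sets_eq_imp_space_eq)
    interpret finite_measure N by standard (use fin in \<open>simp add: space\<close>)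
    show "integrable N (\<lambda>_. B)" by simp
    show "v \<in> borel_measurable N" "u n \<in> borel_measurable N" for n
      using u v by (simp_all add: measurable_cong_sets[OF sets refl])
    show "AE x in N. (\<lambda>n. u n x) \<longlonglongrightarrow> v x" "AE x in N. norm (u n x) \<le> B" for n
      using lim bound by (auto intro!: AE_I2 simp: space)
  qed
  show ?thesis
    unfolding signed_integral_def
  proof (intro tendsto_diff tendsto)
    show "sets (positive_part M m) = sets M" "sets (negative_part M m) = sets M"
      by (simp_all add: positive_part_def negative_part_def)
  qed (simp_all add: emeasure_positive_part emeasure_negative_part)
qed

lemma bounded_signed_measure_if_variation_le:
  assumes m: "signed_measure M m" and var: "variation M m (space M) \<le> ennreal C" and C: "0 \<le> C"
  shows "bounded_signed_measure M m C"
proof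
  show "signed_measure M m" by (rule m)
  fix A assume A: "A \<in> sets M"
  let ?E = "binaryset A (space M - A)"
  have "ennreal \<bar>m A\<bar> \<le> ennreal \<bar>m A\<bar> + ennreal \<bar>m (space M - A)\<bar>" by simp
  also have "\<dots> = (\<Sum>i. ennreal \<bar>m (?E i)\<bar>)"
    using m by (intro suminf_binaryset_eq[symmetric]) (simp add: signed_measure_def)
  also have "\<dots> \<le> variation M m (space M)"
    unfolding variation_def
  proof (intro SUP_upper CollectI conjI)
    show "range ?E \<subseteq> sets M" using A by (auto simp: range_binaryset_eq)
    show "disjoint_family ?E" by (rule disjoint_family_binaryset) auto
    show "(\<Union>i. ?E i) = space M" using sets.sets_into_space[OF A] by (auto simp: UN_binaryset_eq)
  qed
  also note var
  finally show "\<bar>m A\<bar> \<le> C" using C by (simp add: ennreal_le_iff)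
qed

lemma (in bounded_signed_measure) restrict:
  assumes Q: "Q \<in> sets M"
  shows "bounded_signed_measure M (\<lambda>B. m (Q \<inter> B)) C"
proof
  show "signed_measure M (\<lambda>B. m (Q \<inter> B))"
    unfolding signed_measure_def
  proof (intro conjI allI impI)
    show "m (Q \<inter> {}) = 0" by (simp add: empty)
    fix E :: "nat \<Rightarrow> _" assume E: "range E \<subseteq> sets M" "disjoint_family E"
    then have "(\<lambda>i. m (Q \<inter> E i)) sums m (\<Union>i. Q \<inter> E i)"
      using Q by (intro sums_UN) (auto simp: disjoint_family_on_def)
    then show "(\<lambda>i. m (Q \<inter> E i)) sums m (Q \<inter> (\<Union>i. E i))" by (simp only: Int_UN_distrib)
  qed
  show "\<bar>m (Q \<inter> B)\<bar> \<le> C" if "B \<in> sets M" for B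
    using Q that by (intro bounded sets.Int)
qed

lemma (in bounded_signed_measure) uminus: "bounded_signed_measure M (\<lambda>B. - m B) C"
proof
  show "signed_measure M (\<lambda>B. - m B)"
    using signed_measure unfolding signed_measure_def by (auto intro: sums_minus)
  show "\<bar>- m A\<bar> \<le> C" if "A \<in> sets M" for A using bounded[OF that] by simp
qed

text \<open>Countably many values decide the sign. An open set is an increasing union of finite unions of basic
sets, so \<open>m\<close> is nonnegative on it; and outer regularity of the total variation approximates any
Borel set by an open set up to a set of small variation. This passage to the limit replaces a Dynkin argument, which is not available because
nonnegativity is not inherited by complements.\<close>

lemma nonneg_if_nonneg_on_basis:
  fixes S :: "'a::polish_space set"
  assumes "bounded_signed_measure (restrict_space borel S) m C" and S: "S \<in> sets borel"
    and basis: "topological_basis \<B>" "countable \<B>"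
    and nn: "\<And>F. finite F \<Longrightarrow> F \<subseteq> \<B> \<Longrightarrow> 0 \<le> m (S \<inter> \<Union>F)"
    and A: "A \<in> sets (restrict_space borel S)"
  shows "0 \<le> m A"
proof -
  interpret bounded_signed_measure "restrict_space borel S" m C by fact
  obtain P where "hahn_set (restrict_space borel S) m P" using hahn_set_exists ..
  then interpret hahn_decomposition "restrict_space borel S" m C P by unfold_locales
  have sets_iff: "B \<in> sets (restrict_space borel S) \<longleftrightarrow> B \<subseteq> S \<and> B \<in> sets borel" for B
    using S by (simp add: sets_restrict_space_iff)
  have nn_open: "0 \<le> m (S \<inter> U)" if "open U" for U
  proof -
    obtain F where F: "F \<subseteq> \<B>" "\<Union>F = U"
      using basis(1) \<open>open U\<close> unfolding topological_basis_def by blast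
    show ?thesis
    proof (cases "F = {}")
      case True
      then show ?thesis using F by (simp add: empty)
    next
      case False
      have F_range: "range (from_nat_into F) = F"
        using False countable_subset[OF F(1) basis(2)] by (rule range_from_nat_into)
      define E where "E n = S \<inter> \<Union>(from_nat_into F ` {..<n})" for n
      have fin: "from_nat_into F ` {..<n} \<subseteq> \<B>" for n
        using F_range F(1) by blast
      have "open B" if "B \<in> \<B>" for B
        using basis(1) that by (rule topological_basis_open)
      then have "\<Union>(from_nat_into F ` {..<n}) \<in> sets borel" for n
        using fin[of n] by (intro borel_open open_Union) auto
      then have "E n \<in> sets (restrict_space borel S)" for n
        unfolding sets_iff E_def using S by auto
      moreover have "incseq E"
        by (intro incseq_SucI) (auto simp: E_def lessThan_Suc)
      ultimately have "(\<lambda>n. m (E n)) \<longlonglongrightarrow> m (\<Union>n. E n)"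
        by (rule tendsto_incseq)
      moreover have "0 \<le> m (E n)" for n
        unfolding E_def by (intro nn fin) auto
      ultimately have "0 \<le> m (\<Union>n. E n)"
        by (intro LIMSEQ_le_const) auto
      also have "(\<Union>n. E n) = S \<inter> \<Union>(range (from_nat_into F))"
        unfolding E_def by blast
      finally show ?thesis using F by (simp add: F_range)
    qed
  qed
  let ?V = "variation_measure (restrict_space borel S) m"
  have id: "(\<lambda>x. x) \<in> ?V \<rightarrow>\<^sub>M borel"
    by (subst measurable_cong_sets[OF sets_variation_measure refl])
      (rule measurable_restrict_space1, simp)
  define N where "N = distr ?V borel (\<lambda>x. x)"
  interpret V: finite_measure ?V by (rule finite_variation_measure)
  interpret N: finite_measure N unfolding N_def using id by (rule V.finite_measure_distr)
  have N: "emeasure N B = ennreal (pos (S \<inter> B) + neg (S \<inter> B))" if "B \<in> sets borel" for B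
  proof -
    have "S \<inter> B \<in> sets (restrict_space borel S)" using that S by (simp add: sets_iff)
    then show ?thesis
      using that id unfolding N_def
      by (subst emeasure_distr) (simp_all add: emeasure_variation_measure space_restrict_space
          pos_def neg_def Int_commute)
  qed
  have "0 \<le> m A + \<epsilon>" if \<epsilon>: "0 < \<epsilon>" for \<epsilon> :: real
  proof -
    have A': "A \<subseteq> S" "A \<in> sets borel" using A by (simp_all add: sets_iff)
    have "(INF U\<in>{U. A \<subseteq> U \<and> open U}. emeasure N U) = emeasure N A"
      using A' N.emeasure_finite by (intro outer_regular[symmetric]) (auto simp: N_def)
    also have "\<dots> < emeasure N A + ennreal \<epsilon>"
      using \<epsilon> N.emeasure_finite by (simp add: ennreal_add_left_cancel_less less_top[symmetric])
    finally obtain U where U: "A \<subseteq> U" "open U" "emeasure N U < emeasure N A + ennreal \<epsilon>"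
      by (auto simp: INF_less_iff)
    have SU: "S \<inter> U \<in> sets (restrict_space borel S)" using S U by (auto simp: sets_iff)
    define D where "D = S \<inter> U - A"
    have D: "D \<in> sets (restrict_space borel S)" unfolding D_def using SU A by auto
    have AD: "S \<inter> U = A \<union> D" "A \<inter> D = {}" using A' U by (auto simp: D_def)
    have SA: "S \<inter> A = A" using A' by auto
    have U_borel: "U \<in> sets borel" using U(2) by (rule borel_open)
    have "ennreal (pos (A \<union> D) + neg (A \<union> D)) < ennreal (pos A + neg A + \<epsilon>)"
      using U(3) \<epsilon> pos_nonneg[OF A] neg_nonneg[OF A]
      unfolding N[OF U_borel] N[OF A'(2)] AD(1) SA by (subst ennreal_plus) auto
    then have "pos (A \<union> D) + neg (A \<union> D) < pos A + neg A + \<epsilon>"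
      using pos_nonneg[OF SU] neg_nonneg[OF SU] by (simp add: AD ennreal_less_iff del: ennreal_plus)
    moreover have "pos (A \<union> D) = pos A + pos D" "neg (A \<union> D) = neg A + neg D"
    proof -
      have "(A \<union> D) \<inter> P = A \<inter> P \<union> D \<inter> P" "(A \<union> D) - P = (A - P) \<union> (D - P)" by auto
      then show "pos (A \<union> D) = pos A + pos D" "neg (A \<union> D) = neg A + neg D"
        unfolding pos_def neg_def
        using A D P AD(2) Un_disjoint[of "A \<inter> P" "D \<inter> P"] Un_disjoint[of "A - P" "D - P"]
        by (auto simp: disjoint_iff)
    qed
    ultimately have "\<bar>m D\<bar> < \<epsilon>" using abs_le[OF D] by linarith
    moreover have "m (S \<inter> U) = m A + m D"
      unfolding AD(1) using A D AD(2) by (rule Un_disjoint)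
    ultimately show ?thesis using nn_open[OF U(2)] by linarith
  qed
  then show ?thesis
    by (rule field_le_epsilon)
qed

section \<open>Kernels of signed measures and the integrated measure\<close>

definition slice :: "(real \<times> real) set \<Rightarrow> real \<Rightarrow> real set" where
  "slice A \<tau> = {s \<in> {-1..0}. (\<tau>, s) \<in> A}"

lemma slice_simps:
  "slice {} \<tau> = {}"
  "slice (A \<union> B) \<tau> = slice A \<tau> \<union> slice B \<tau>"
  "slice (A \<inter> B) \<tau> = slice A \<tau> \<inter> slice B \<tau>"
  "slice (A - B) \<tau> = slice A \<tau> - slice B \<tau>"
  "slice (\<Union>i. E i) \<tau> = (\<Union>i. slice (E i) \<tau>)"
  by (auto simp: slice_def)

lemma sets_rect_borel_iff:
  "A \<in> sets (rect_borel T) \<longleftrightarrow> A \<subseteq> {0..T} \<times> {-1..0} \<and> A \<in> sets borel"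
proof (rule sets_restrict_space_iff)
  show "{0..T} \<times> {-1..0} \<inter> space borel \<in> sets (borel :: (real \<times> real) measure)"
    unfolding space_borel Int_UNIV_right by (intro borel_closed closed_Times closed_atLeastAtMost)
qed

lemma sets_delay_borel_iff: "B \<in> sets delay_borel \<longleftrightarrow> B \<subseteq> {-1..0} \<and> B \<in> sets borel"
  by (subst sets_restrict_space_iff) auto

lemma measurable_Pair_rect_borel:
  assumes "\<tau> \<in> {0..T}"
  shows "Pair \<tau> \<in> delay_borel \<rightarrow>\<^sub>M rect_borel T"
proof (intro measurable_restrict_space2 measurable_restrict_space1)
  show "Pair \<tau> \<in> space delay_borel \<rightarrow> {0..T} \<times> {-1..0}"
    using assms by (simp add: space_restrict_space)
  show "Pair \<tau> \<in> borel \<rightarrow>\<^sub>M (borel :: (real \<times> real) measure)"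
    unfolding borel_prod[symmetric] by (rule measurable_Pair1') simp
qed

lemma slice_sets: 
  assumes "A \<in> sets borel"
  shows "slice A \<tau> \<in> sets delay_borel"
proof -
  have "Pair \<tau> -` A \<in> sets borel"
    using assms measurable_sets[OF measurable_Pair1'[of \<tau> borel borel], of A]
    by (simp only: borel_prod space_borel Int_UNIV_right UNIV_I)
  moreover have "slice A \<tau> = Pair \<tau> -` A \<inter> {-1..0}" by (auto simp: slice_def)
  ultimately show ?thesis by (simp add: sets_delay_borel_iff)
qed

text \<open>The functions required to be measurable are the integrands that define the integrated measure.\<close>

locale bounded_signed_kernel =
  fixes T C :: real and \<mu> :: "real \<Rightarrow> real set \<Rightarrow> real"
  assumes kernel: "\<tau> \<in> {0..T} \<Longrightarrow> bounded_signed_measure delay_borel (\<mu> \<tau>) C"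
    and measurable_slice: "A \<in> sets borel \<Longrightarrow>
      (\<lambda>\<tau>. \<mu> \<tau> (slice A \<tau>)) \<in> borel_measurable (lebesgue_on {0..T})"
begin

abbreviation \<nu> :: "(real \<times> real) set \<Rightarrow> real" where
  "\<nu> \<equiv> integrated_measure T \<mu>"

lemma \<nu>_eq: "\<nu> A = (\<integral>\<tau>. \<mu> \<tau> (slice A \<tau>) \<partial>lebesgue_on {0..T})"
  by (simp add: integrated_measure_def slice_def)

lemma uminus: "bounded_signed_kernel T C (\<lambda>\<tau> B. - \<mu> \<tau> B)"
  using bounded_signed_measure.uminus[OF kernel] measurable_slice
  by (intro bounded_signed_kernel.intro) auto

lemma abs_slice_le: "\<tau> \<in> {0..T} \<Longrightarrow> A \<in> sets borel \<Longrightarrow> \<bar>\<mu> \<tau> (slice A \<tau>)\<bar> \<le> C"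
  by (rule bounded_signed_measure.bounded[OF kernel slice_sets])

lemma integrable_slice:
  assumes "A \<in> sets borel"
  shows "integrable (lebesgue_on {0..T}) (\<lambda>\<tau>. \<mu> \<tau> (slice A \<tau>))"
proof (rule Bochner_Integration.integrable_bound)
  show "integrable (lebesgue_on {0..T}) (\<lambda>_. C)" by simp
  show "(\<lambda>\<tau>. \<mu> \<tau> (slice A \<tau>)) \<in> borel_measurable (lebesgue_on {0..T})"
    using assms by (rule measurable_slice)
  show "AE \<tau> in lebesgue_on {0..T}. norm (\<mu> \<tau> (slice A \<tau>)) \<le> norm C"
  proof (rule AE_I2)
    fix \<tau> assume "\<tau> \<in> space (lebesgue_on {0..T})"
    then have "\<bar>\<mu> \<tau> (slice A \<tau>)\<bar> \<le> C"
      using assms by (intro abs_slice_le) (simp_all add: space_restrict_space)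
    then show "norm (\<mu> \<tau> (slice A \<tau>)) \<le> norm C" by simp
  qed
qed

text \<open>Countable additivity is inherited pointwise in \<open>\<tau>\<close>: the partial sums are values of \<open>\<mu> \<tau>\<close> on
finite unions, hence bounded by \<open>C\<close>, and dominated convergence applies.\<close>

lemma bounded_signed_measure_integrated:
  "bounded_signed_measure (rect_borel T) \<nu> (\<integral>\<tau>. C \<partial>lebesgue_on {0..T})"
proof
  show "signed_measure (rect_borel T) \<nu>"
    unfolding signed_measure_def
  proof (intro conjI allI impI)
    show "\<nu> {} = 0"
      unfolding \<nu>_eq using bounded_signed_measure.empty[OF kernel]
      by (intro integral_eq_zero_AE AE_I2) (simp add: slice_simps space_restrict_space)
    fix E :: "nat \<Rightarrow> _" assume E: "range E \<subseteq> sets (rect_borel T)" "disjoint_family E"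
    have E_borel: "E i \<in> sets borel" for i using E(1) sets_rect_borel_iff by blast
    have disj: "disjoint_family (\<lambda>i. slice (E i) \<tau>)" for \<tau>
      using E(2) by (auto simp: disjoint_family_on_def slice_def)
    have UN_lessThan: "(\<Sum>i<n. \<mu> \<tau> (slice (E i) \<tau>)) = \<mu> \<tau> (slice (\<Union>i<n. E i) \<tau>)"
      if "\<tau> \<in> {0..T}" for n \<tau>
    proof (induction n)
      case 0
      show ?case using bounded_signed_measure.empty[OF kernel[OF that]] by (simp add: slice_simps)
    next
      case (Suc n)
      have "(\<Union>i<n. E i) \<inter> E n = {}"
        using E(2) by (auto simp: disjoint_family_on_def dest: less_imp_neq)
      then have "slice (\<Union>i<n. E i) \<tau> \<inter> slice (E n) \<tau> = {}"
        by (simp add: slice_simps flip: slice_simps(3))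
      then have "\<mu> \<tau> (slice (\<Union>i<n. E i) \<tau> \<union> slice (E n) \<tau>)
          = \<mu> \<tau> (slice (\<Union>i<n. E i) \<tau>) + \<mu> \<tau> (slice (E n) \<tau>)"
        using E_borel by (intro bounded_signed_measure.Un_disjoint[OF kernel[OF that]] slice_sets) auto
      then show ?case
        using Suc by (simp add: lessThan_Suc Un_commute flip: slice_simps(2))
    qed
    have "(\<lambda>n. \<integral>\<tau>. (\<Sum>i<n. \<mu> \<tau> (slice (E i) \<tau>)) \<partial>lebesgue_on {0..T})
        \<longlonglongrightarrow> (\<integral>\<tau>. \<mu> \<tau> (slice (\<Union>i. E i) \<tau>) \<partial>lebesgue_on {0..T})"
    proof (rule integral_dominated_convergence[where w="\<lambda>_. C"])
      show "integrable (lebesgue_on {0..T}) (\<lambda>_. C)" by simp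
      show "AE \<tau> in lebesgue_on {0..T}. (\<lambda>n. \<Sum>i<n. \<mu> \<tau> (slice (E i) \<tau>)) \<longlonglongrightarrow> \<mu> \<tau> (slice (\<Union>i. E i) \<tau>)"
      proof (rule AE_I2)
        fix \<tau> assume "\<tau> \<in> space (lebesgue_on {0..T})"
        then have \<tau>: "\<tau> \<in> {0..T}" by (simp add: space_restrict_space)
        show "(\<lambda>n. \<Sum>i<n. \<mu> \<tau> (slice (E i) \<tau>)) \<longlonglongrightarrow> \<mu> \<tau> (slice (\<Union>i. E i) \<tau>)"
          using bounded_signed_measure.sums_UN[OF kernel[OF \<tau>] slice_sets[OF E_borel] disj]
          by (simp add: sums_def slice_simps)
      qed
      show "AE \<tau> in lebesgue_on {0..T}. norm (\<Sum>i<n. \<mu> \<tau> (slice (E i) \<tau>)) \<le> C" for n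
        using E_borel by (intro AE_I2) (auto simp: UN_lessThan space_restrict_space intro!: abs_slice_le)
      have UN: "(\<Union>i. E i) \<in> sets borel" using E_borel by auto
      show "(\<lambda>\<tau>. \<mu> \<tau> (slice (\<Union>i. E i) \<tau>)) \<in> borel_measurable (lebesgue_on {0..T})"
        by (rule measurable_slice[OF UN])
      show "(\<lambda>\<tau>. \<Sum>i<n. \<mu> \<tau> (slice (E i) \<tau>)) \<in> borel_measurable (lebesgue_on {0..T})" for n
        by (intro borel_measurable_sum measurable_slice E_borel)
    qed
    then show "(\<lambda>i. \<nu> (E i)) sums \<nu> (\<Union>i. E i)"
      using integrable_slice[OF E_borel]
      by (simp add: sums_def \<nu>_eq)
  qed
  fix A assume "A \<in> sets (rect_borel T)"
  then have A: "A \<in> sets borel" by (simp only: sets_rect_borel_iff)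
  have "\<bar>\<nu> A\<bar> \<le> (\<integral>\<tau>. \<bar>\<mu> \<tau> (slice A \<tau>)\<bar> \<partial>lebesgue_on {0..T})"
    unfolding \<nu>_eq by (rule integral_abs_bound)
  also have "\<dots> \<le> (\<integral>\<tau>. C \<partial>lebesgue_on {0..T})"
    using A integrable_slice abs_slice_le
    by (intro integral_mono) (auto simp: space_restrict_space)
  finally show "\<bar>\<nu> A\<bar> \<le> (\<integral>\<tau>. C \<partial>lebesgue_on {0..T})" .
qed

text \<open>The hypothesis is that \<open>\<tau> \<mapsto> \<mu> \<tau> (slice G \<tau>)\<close> has a nonnegative integral over every Borel set of
times; it is tested on the set where this function is negative.\<close>

lemma AE_nonneg_slice:
  assumes G: "G \<in> sets borel"
    and nn: "\<And>E. E \<in> sets borel \<Longrightarrow> 0 \<le> \<nu> (G \<inter> (E \<inter> {0..T}) \<times> UNIV)"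
  shows "AE \<tau> in lebesgue_on {0..T}. 0 \<le> \<mu> \<tau> (slice G \<tau>)"
proof -
  define g where "g \<tau> = \<mu> \<tau> (slice G \<tau>)" for \<tau>
  have g: "g \<in> borel_measurable (lebesgue_on {0..T})" "integrable (lebesgue_on {0..T}) g"
    using measurable_slice[OF G] integrable_slice[OF G] by (simp_all add: g_def[abs_def])
  define E where "E = {\<tau> \<in> {0..T}. g \<tau> < 0}"
  have "{\<tau> \<in> space (lebesgue_on {0..T}). g \<tau> < 0} \<in> sets (lebesgue_on {0..T})"
    using g(1) by measurable
  then have E: "E \<in> sets lebesgue"
    by (simp add: sets_restrict_space_iff space_restrict_space E_def)
  \<comment> \<open>\<open>E\<close> is only Lebesgue measurable, while \<open>\<nu>\<close> may be tested on Borel sets of times alone: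
    pass to a Borel subset that differs from \<open>E\<close> by a null set.\<close>
  then obtain E' N N' where E': "E = E' \<union> N" "N \<subseteq> N'" "N' \<in> null_sets lborel" "E' \<in> sets lborel"
    by (rule sets_completionE)
  have E'_sub: "E' \<subseteq> {0..T}" using E' by (auto simp: E_def)
  have empty: "\<mu> \<tau> {} = 0" if "\<tau> \<in> {0..T}" for \<tau>
    using bounded_signed_measure.empty[OF kernel[OF that]] .
  have le0: "indicator E' \<tau> * g \<tau> \<le> 0" for \<tau>
  proof (cases "\<tau> \<in> E'")
    case True
    then have "\<tau> \<in> E" using E'(1) by auto
    then show ?thesis by (simp add: E_def True)
  qed simp
  have int: "integrable (lebesgue_on {0..T}) (\<lambda>\<tau>. indicator E' \<tau> * g \<tau>)"
  proof -
    have "E' \<in> sets (lebesgue_on {0..T})"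
      using E' E'_sub by (simp add: sets_restrict_space_iff)
    from integrable_real_mult_indicator[OF this g(2)] show ?thesis by (simp add: mult.commute)
  qed
  have "\<nu> (G \<inter> (E' \<inter> {0..T}) \<times> UNIV) = (\<integral>\<tau>. indicator E' \<tau> * g \<tau> \<partial>lebesgue_on {0..T})"
    unfolding \<nu>_eq g_def
  proof (rule Bochner_Integration.integral_cong[OF refl])
    fix \<tau> assume "\<tau> \<in> space (lebesgue_on {0..T})"
    then have \<tau>: "\<tau> \<in> {0..T}" by (simp add: space_restrict_space)
    have "slice (G \<inter> (E' \<inter> {0..T}) \<times> UNIV) \<tau> = (if \<tau> \<in> E' then slice G \<tau> else {})"
      using \<tau> by (auto simp: slice_def)
    then show "\<mu> \<tau> (slice (G \<inter> (E' \<inter> {0..T}) \<times> UNIV) \<tau>) = indicator E' \<tau> * \<mu> \<tau> (slice G \<tau>)"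
      using empty[OF \<tau>] by simp
  qed
  then have "0 \<le> (\<integral>\<tau>. indicator E' \<tau> * g \<tau> \<partial>lebesgue_on {0..T})"
    using nn[of E'] E' by simp
  moreover have "(\<integral>\<tau>. indicator E' \<tau> * g \<tau> \<partial>lebesgue_on {0..T}) \<le> 0"
    using integral_nonneg_AE[of "\<lambda>\<tau>. - (indicator E' \<tau> * g \<tau>)" "lebesgue_on {0..T}"] le0 by simp
  ultimately have "(\<integral>\<tau>. - (indicator E' \<tau> * g \<tau>) \<partial>lebesgue_on {0..T}) = 0"
    by simp
  then have "AE \<tau> in lebesgue_on {0..T}. - (indicator E' \<tau> * g \<tau>) = 0"
    using int le0 by (subst (asm) integral_nonneg_eq_0_iff_AE) auto
  moreover have "AE \<tau> in lebesgue_on {0..T}. \<tau> \<notin> N'"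
    using AE_completion[OF AE_not_in[OF E'(3)]] by (subst AE_restrict_space_iff) (auto elim: eventually_mono)
  moreover have "AE \<tau> in lebesgue_on {0..T}. \<tau> \<in> {0..T}"
    by (intro AE_I2) (simp add: space_restrict_space)
  ultimately show ?thesis
  proof eventually_elim
    fix \<tau> assume *: "- (indicator E' \<tau> * g \<tau>) = 0" "\<tau> \<notin> N'" "\<tau> \<in> {0..T}"
    have "\<not> g \<tau> < 0"
    proof
      assume "g \<tau> < 0"
      then have "\<tau> \<in> E" using * by (simp add: E_def)
      then have "\<tau> \<in> E'" using * E' by auto
      with * \<open>g \<tau> < 0\<close> show False by simp
    qed
    then show "0 \<le> \<mu> \<tau> (slice G \<tau>)" by (simp add: g_def)
  qed
qed

text \<open>For a single set \<open>B\<close> the exceptional null set of times depends on \<open>B\<close>. The finite unions of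
basic open sets are countably many, so one null set serves all of them, and by
\<open>nonneg_if_nonneg_on_basis\<close> it then serves all Borel sets.\<close>

lemma AE_slice_positive_set:
  assumes P: "P \<in> sets (rect_borel T)"
    and nn: "\<And>A. A \<in> sets (rect_borel T) \<Longrightarrow> A \<subseteq> P \<Longrightarrow> 0 \<le> \<nu> A"
  shows "AE \<tau> in lebesgue_on {0..T}. \<forall>B\<in>sets delay_borel. 0 \<le> \<mu> \<tau> (slice P \<tau> \<inter> B)"
proof -
  obtain \<B> :: "real set set" where \<B>: "countable \<B>" "topological_basis \<B>"
    using ex_countable_basis by blast
  have "AE \<tau> in lebesgue_on {0..T}. \<forall>F\<in>{F. finite F \<and> F \<subseteq> \<B>}. 0 \<le> \<mu> \<tau> (slice (P \<inter> UNIV \<times> \<Union>F) \<tau>)"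
  proof (rule AE_ball_countable')
    show "countable {F. finite F \<and> F \<subseteq> \<B>}"
      using \<B>(1) by (rule countable_Collect_finite_subset)
    fix F assume F: "F \<in> {F. finite F \<and> F \<subseteq> \<B>}"
    then have "open (\<Union>F)" using topological_basis_open[OF \<B>(2)] by (intro open_Union) auto
    then have G: "P \<inter> UNIV \<times> \<Union>F \<in> sets borel"
      using P unfolding sets_rect_borel_iff by (intro sets.Int) (auto intro: borel_open open_Times)
    show "AE \<tau> in lebesgue_on {0..T}. 0 \<le> \<mu> \<tau> (slice (P \<inter> UNIV \<times> \<Union>F) \<tau>)"
    proof (rule AE_nonneg_slice[OF G])
      fix E :: "real set" assume "E \<in> sets borel"
      then have "(E \<inter> {0..T}) \<times> (UNIV :: real set) \<in> sets borel"
        unfolding borel_prod[symmetric] by (intro pair_measureI) auto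
      with G have "P \<inter> UNIV \<times> \<Union>F \<inter> (E \<inter> {0..T}) \<times> UNIV \<in> sets borel" by (rule sets.Int)
      then show "0 \<le> \<nu> (P \<inter> UNIV \<times> \<Union>F \<inter> (E \<inter> {0..T}) \<times> UNIV)"
        using P by (intro nn) (auto simp: sets_rect_borel_iff)
    qed
  qed
  moreover have "AE \<tau> in lebesgue_on {0..T}. \<tau> \<in> {0..T}"
    by (intro AE_I2) (simp add: space_restrict_space)
  ultimately show ?thesis
  proof eventually_elim
    fix \<tau> assume *: "\<forall>F\<in>{F. finite F \<and> F \<subseteq> \<B>}. 0 \<le> \<mu> \<tau> (slice (P \<inter> UNIV \<times> \<Union>F) \<tau>)"
      and \<tau>: "\<tau> \<in> {0..T}"
    have P_slice: "slice P \<tau> \<in> sets delay_borel"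
      using P unfolding sets_rect_borel_iff by (intro slice_sets) auto
    show "\<forall>B\<in>sets delay_borel. 0 \<le> \<mu> \<tau> (slice P \<tau> \<inter> B)"
    proof (rule ballI, rule nonneg_if_nonneg_on_basis[where m="\<lambda>B. \<mu> \<tau> (slice P \<tau> \<inter> B)" and S="{-1..0}", OF _ _ \<B>(2,1)])
      show "bounded_signed_measure delay_borel (\<lambda>B. \<mu> \<tau> (slice P \<tau> \<inter> B)) C"
        using kernel[OF \<tau>] P_slice by (rule bounded_signed_measure.restrict)
      fix F assume "finite F" "F \<subseteq> \<B>"
      moreover have "slice (P \<inter> UNIV \<times> \<Union>F) \<tau> = slice P \<tau> \<inter> ({-1..0} \<inter> \<Union>F)"
        by (auto simp: slice_def)
      ultimately show "0 \<le> \<mu> \<tau> (slice P \<tau> \<inter> ({-1..0} \<inter> \<Union>F))" using * by auto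
    qed simp_all
  qed
qed

end

section \<open>Mixtures of measures\<close>

text \<open>\<open>R\<close> is the mixture of the measures \<open>\<kappa> x\<close> with respect to \<open>M\<close>. The measures \<open>\<kappa> x\<close> all live on the
space of \<open>R\<close>: a disintegration over slices is covered by pushing the slice measures forward into the
product.\<close>

locale measure_mixture =
  fixes M :: "'a measure" and R :: "'b measure" and \<kappa> :: "'a \<Rightarrow> 'b measure"
  assumes sets_kernel: "sets (\<kappa> x) = sets R"
    and measurable_emeasure: "A \<in> sets R \<Longrightarrow> (\<lambda>x. emeasure (\<kappa> x) A) \<in> borel_measurable M"
    and emeasure_eq: "A \<in> sets R \<Longrightarrow> emeasure R A = (\<integral>\<^sup>+x. emeasure (\<kappa> x) A \<partial>M)"
begin

lemma space_kernel: "space (\<kappa> x) = space R"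
  using sets_kernel by (rule sets_eq_imp_space_eq)

lemma nn_integral_mixture:
  assumes "f \<in> borel_measurable R"
  shows "(\<lambda>x. \<integral>\<^sup>+y. f y \<partial>\<kappa> x) \<in> borel_measurable M \<and>
    (\<integral>\<^sup>+y. f y \<partial>R) = (\<integral>\<^sup>+x. \<integral>\<^sup>+y. f y \<partial>\<kappa> x \<partial>M)"
  using assms
proof (induction f rule: borel_measurable_induct)
  case (cong f g)
  have "(\<integral>\<^sup>+y. f y \<partial>\<kappa> x) = (\<integral>\<^sup>+y. g y \<partial>\<kappa> x)" for x
    using cong(3) by (intro nn_integral_cong) (simp add: space_kernel)
  moreover have "(\<integral>\<^sup>+y. f y \<partial>R) = (\<integral>\<^sup>+y. g y \<partial>R)"
    using cong(3) by (intro nn_integral_cong) simp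
  ultimately show ?case using cong(4) by simp
next
  case (set A)
  then show ?case using measurable_emeasure emeasure_eq by (simp add: sets_kernel)
next
  case (mult u c)
  have [measurable]: "u \<in> borel_measurable (\<kappa> x)" for x
    using mult(2) by (simp add: measurable_cong_sets[OF sets_kernel refl])
  have [measurable]: "(\<lambda>x. \<integral>\<^sup>+y. u y \<partial>\<kappa> x) \<in> borel_measurable M" using mult(4) by simp
  have "(\<lambda>x. c * (\<integral>\<^sup>+y. u y \<partial>\<kappa> x)) \<in> borel_measurable M" by measurable
  then show ?case using mult by (simp add: nn_integral_cmult)
next
  case (add u v)
  have [measurable]: "u \<in> borel_measurable (\<kappa> x)" "v \<in> borel_measurable (\<kappa> x)" for x
    using add(1,3) by (simp_all add: measurable_cong_sets[OF sets_kernel refl])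
  have [measurable]: "(\<lambda>x. \<integral>\<^sup>+y. u y \<partial>\<kappa> x) \<in> borel_measurable M"
    "(\<lambda>x. \<integral>\<^sup>+y. v y \<partial>\<kappa> x) \<in> borel_measurable M"
    using add(6,7) by simp_all
  have "(\<lambda>x. (\<integral>\<^sup>+y. v y \<partial>\<kappa> x) + (\<integral>\<^sup>+y. u y \<partial>\<kappa> x)) \<in> borel_measurable M" by measurable
  then show ?case using add by (simp add: nn_integral_add)
next
  case (seq U)
  have U: "U i \<in> borel_measurable (\<kappa> x)" for i x
    using seq(1) by (simp add: measurable_cong_sets[OF sets_kernel refl])
  have kernel: "(\<integral>\<^sup>+y. (SUP i. U i) y \<partial>\<kappa> x) = (SUP i. \<integral>\<^sup>+y. U i y \<partial>\<kappa> x)" for x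
    unfolding SUP_apply by (rule nn_integral_monotone_convergence_SUP[OF seq(3) U])
  have "(\<integral>\<^sup>+y. (SUP i. U i) y \<partial>R) = (SUP i. \<integral>\<^sup>+y. U i y \<partial>R)"
    unfolding SUP_apply by (rule nn_integral_monotone_convergence_SUP[OF seq(3,1)])
  also have "\<dots> = (SUP i. \<integral>\<^sup>+x. \<integral>\<^sup>+y. U i y \<partial>\<kappa> x \<partial>M)"
    using seq(5) by simp
  also have "\<dots> = (\<integral>\<^sup>+x. (SUP i. \<integral>\<^sup>+y. U i y \<partial>\<kappa> x) \<partial>M)"
  proof (rule nn_integral_monotone_convergence_SUP[symmetric])
    show "incseq (\<lambda>i x. \<integral>\<^sup>+y. U i y \<partial>\<kappa> x)"
      using seq(3) by (auto simp: incseq_def le_fun_def intro!: nn_integral_mono)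
  qed (use seq(5) in auto)
  finally show ?case
    unfolding kernel using seq(5) by (intro conjI borel_measurable_SUP) auto
qed

text \<open>The identity for nonnegative functions, applied to the positive and the negative part of \<open>f\<close>. As the
integral of a non-integrable function is \<open>0\<close>, the inner integral is measurable on all of \<open>M\<close>.\<close>

lemma integral_mixture:
  fixes f :: "'b \<Rightarrow> real"
  assumes f: "integrable R f"
  shows "AE x in M. integrable (\<kappa> x) f"
    and "integrable M (\<lambda>x. \<integral>y. f y \<partial>\<kappa> x)"
    and "(\<integral>x. \<integral>y. f y \<partial>\<kappa> x \<partial>M) = (\<integral>y. f y \<partial>R)"
proof -
  have [measurable]: "f \<in> borel_measurable R" using f by (rule borel_measurable_integrable)
  have f_kernel [measurable]: "f \<in> borel_measurable (\<kappa> x)" for x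
    by (simp add: measurable_cong_sets[OF sets_kernel refl])
  define p where "p x = (\<integral>\<^sup>+y. ennreal (f y) \<partial>\<kappa> x)" for x
  define n where "n x = (\<integral>\<^sup>+y. ennreal (- f y) \<partial>\<kappa> x)" for x
  have p: "p \<in> borel_measurable M" "(\<integral>\<^sup>+y. ennreal (f y) \<partial>R) = (\<integral>\<^sup>+x. p x \<partial>M)"
    using nn_integral_mixture[of "\<lambda>y. ennreal (f y)"] by (simp_all add: p_def[abs_def])
  have n: "n \<in> borel_measurable M" "(\<integral>\<^sup>+y. ennreal (- f y) \<partial>R) = (\<integral>\<^sup>+x. n x \<partial>M)"
    using nn_integral_mixture[of "\<lambda>y. ennreal (- f y)"] by (simp_all add: n_def[abs_def])
  have fin: "(\<integral>\<^sup>+x. p x \<partial>M) \<noteq> \<infinity>" "(\<integral>\<^sup>+x. n x \<partial>M) \<noteq> \<infinity>"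
    using f p(2) n(2) by (auto simp: real_integrable_def)
  have AE_p: "AE x in M. p x \<noteq> \<infinity>" and AE_n: "AE x in M. n x \<noteq> \<infinity>"
    using nn_integral_noteq_infinite[OF p(1) fin(1)] nn_integral_noteq_infinite[OF n(1) fin(2)] .
  from AE_p AE_n show "AE x in M. integrable (\<kappa> x) f"
    by eventually_elim (simp add: real_integrable_def p_def n_def)
  have eq: "(\<integral>y. f y \<partial>\<kappa> x)
      = (if p x \<noteq> \<infinity> \<and> n x \<noteq> \<infinity> then enn2real (p x) - enn2real (n x) else 0)" for x
  proof -
    have iff: "integrable (\<kappa> x) f \<longleftrightarrow> p x \<noteq> \<infinity> \<and> n x \<noteq> \<infinity>"
      by (simp add: real_integrable_def p_def n_def)
    show ?thesis
    proof (cases "integrable (\<kappa> x) f")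
      case True
      then have "(\<integral>y. f y \<partial>\<kappa> x) = enn2real (p x) - enn2real (n x)"
        unfolding p_def n_def by (rule real_lebesgue_integral_def)
      with True iff show ?thesis by simp
    next
      case False
      then have "(\<integral>y. f y \<partial>\<kappa> x) = 0" by (rule not_integrable_integral_eq)
      with False iff show ?thesis by auto
    qed
  qed
  have meas: "(\<lambda>x. \<integral>y. f y \<partial>\<kappa> x) \<in> borel_measurable M"
    unfolding eq using p(1) n(1) by measurable
  have real: "integrable M (\<lambda>x. enn2real (g x)) \<and> (\<integral>x. enn2real (g x) \<partial>M) = enn2real (\<integral>\<^sup>+x. g x \<partial>M)"
    if g [measurable]: "g \<in> borel_measurable M" and g_fin: "(\<integral>\<^sup>+x. g x \<partial>M) \<noteq> \<infinity>" for g
  proof -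
    have "AE x in M. ennreal (enn2real (g x)) = g x"
      using nn_integral_noteq_infinite[OF g g_fin]
      by eventually_elim (simp add: less_top)
    then have *: "(\<integral>\<^sup>+x. ennreal (enn2real (g x)) \<partial>M) = (\<integral>\<^sup>+x. g x \<partial>M)"
      by (rule nn_integral_cong_AE)
    moreover have "integrable M (\<lambda>x. enn2real (g x))"
      using g_fin * by (intro integrableI_nonneg) (auto simp: less_top)
    ultimately show ?thesis
      by (simp add: integral_eq_nn_integral)
  qed
  have AE_eq: "AE x in M. enn2real (p x) - enn2real (n x) = (\<integral>y. f y \<partial>\<kappa> x)"
    using AE_p AE_n by eventually_elim (simp add: eq)
  have meas_diff: "(\<lambda>x. enn2real (p x) - enn2real (n x)) \<in> borel_measurable M"
    using p(1) n(1) by measurable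
  have "integrable M (\<lambda>x. enn2real (p x) - enn2real (n x))"
    using real[OF p(1) fin(1)] real[OF n(1) fin(2)] by simp
  then show "integrable M (\<lambda>x. \<integral>y. f y \<partial>\<kappa> x)"
    by (rule integrable_cong_AE[THEN iffD1, OF meas_diff meas AE_eq])
  have "(\<integral>x. \<integral>y. f y \<partial>\<kappa> x \<partial>M) = (\<integral>x. enn2real (p x) - enn2real (n x) \<partial>M)"
    by (rule integral_cong_AE[OF meas_diff meas AE_eq, symmetric])
  also have "\<dots> = enn2real (\<integral>\<^sup>+x. p x \<partial>M) - enn2real (\<integral>\<^sup>+x. n x \<partial>M)"
    using real[OF p(1) fin(1)] real[OF n(1) fin(2)] by simp
  also have "\<dots> = (\<integral>y. f y \<partial>R)"
    using f by (simp add: real_lebesgue_integral_def p n)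
  finally show "(\<integral>x. \<integral>y. f y \<partial>\<kappa> x \<partial>M) = (\<integral>y. f y \<partial>R)" .
qed

end

section \<open>Fubini for the integrated measure\<close>

lemma borel_measurable_lebesgue_on_AE:
  fixes u v :: "'a::euclidean_space \<Rightarrow> 'b::euclidean_space"
  assumes S: "S \<in> sets lebesgue" and u: "u \<in> borel_measurable (lebesgue_on S)"
    and eq: "AE x in lebesgue_on S. u x = v x"
  shows "v \<in> borel_measurable (lebesgue_on S)"
proof -
  have iff: "w \<in> borel_measurable (lebesgue_on S) \<longleftrightarrow>
      (\<lambda>x. if x \<in> S then w x else 0) \<in> borel_measurable lebesgue" for w :: "'a \<Rightarrow> 'b"
    using S by (intro measurable_restrict_space_iff) auto
  have "AE x in lebesgue. x \<in> S \<longrightarrow> u x = v x"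
    using eq S by (subst (asm) AE_restrict_space_iff) auto
  then have "AE x in lebesgue. (if x \<in> S then u x else 0) = (if x \<in> S then v x else 0)"
    by eventually_elim simp
  with u show ?thesis unfolding iff by (rule borel_measurable_AE)
qed

context bounded_signed_kernel
begin

text \<open>The heart of the argument: a Hahn set of \<open>\<nu>\<close> is one for almost every \<open>\<mu> \<tau>\<close>, slice by slice.
The positive half is \<open>AE_slice_positive_set\<close>; the negative half is the same for the kernel
\<open>-\<mu>\<close> and the complementary set.\<close>

lemma AE_hahn_set_slice:
  assumes P: "hahn_set (rect_borel T) \<nu> P"
  shows "AE \<tau> in lebesgue_on {0..T}. hahn_set delay_borel (\<mu> \<tau>) (slice P \<tau>)"
proof -
  interpret neg: bounded_signed_kernel T C "\<lambda>\<tau> B. - \<mu> \<tau> B" by (rule uminus)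
  have neg_\<nu>: "neg.\<nu> A = - \<nu> A" for A unfolding neg.\<nu>_eq \<nu>_eq by simp
  define Q where "Q = {0..T} \<times> {-1..0} - P"
  have P_sets: "P \<in> sets (rect_borel T)" using P by (simp add: hahn_set_def)
  have "space (rect_borel T) - P \<in> sets (rect_borel T)" using P_sets by (rule sets.compl_sets)
  then have Q_sets: "Q \<in> sets (rect_borel T)" by (simp add: Q_def space_restrict_space)
  have "AE \<tau> in lebesgue_on {0..T}. \<forall>B\<in>sets delay_borel. 0 \<le> \<mu> \<tau> (slice P \<tau> \<inter> B)"
    using P by (intro AE_slice_positive_set) (auto simp: hahn_set_def)
  moreover have "AE \<tau> in lebesgue_on {0..T}. \<forall>B\<in>sets delay_borel. 0 \<le> - \<mu> \<tau> (slice Q \<tau> \<inter> B)"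
  proof (rule neg.AE_slice_positive_set[OF Q_sets])
    fix A assume A: "A \<in> sets (rect_borel T)" "A \<subseteq> Q"
    then have "A \<inter> P = {}" by (auto simp: Q_def)
    with P A(1) show "0 \<le> neg.\<nu> A" by (simp add: neg_\<nu> hahn_set_def)
  qed
  moreover have "AE \<tau> in lebesgue_on {0..T}. \<tau> \<in> {0..T}"
    by (intro AE_I2) (simp add: space_restrict_space)
  ultimately show ?thesis
  proof eventually_elim
    fix \<tau> assume pos: "\<forall>B\<in>sets delay_borel. 0 \<le> \<mu> \<tau> (slice P \<tau> \<inter> B)"
      and neg: "\<forall>B\<in>sets delay_borel. 0 \<le> - \<mu> \<tau> (slice Q \<tau> \<inter> B)" and \<tau>: "\<tau> \<in> {0..T}"
    show "hahn_set delay_borel (\<mu> \<tau>) (slice P \<tau>)"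
      unfolding hahn_set_def
    proof (intro conjI ballI impI)
      show "slice P \<tau> \<in> sets delay_borel"
        using P_sets unfolding sets_rect_borel_iff by (intro slice_sets) simp
      fix B assume B: "B \<in> sets delay_borel"
      show "0 \<le> \<mu> \<tau> B" if "B \<subseteq> slice P \<tau>"
        using pos[rule_format, OF B] that by (simp add: Int_absorb1)
      show "\<mu> \<tau> B \<le> 0" if "B \<inter> slice P \<tau> = {}"
      proof -
        have "B \<subseteq> {-1..0}" using B unfolding sets_delay_borel_iff by simp
        then have "slice Q \<tau> \<inter> B = B" using that \<tau> by (fastforce simp: slice_def Q_def)
        then show ?thesis using neg[rule_format, OF B] by simp
      qed
    qed
  qed
qed

text \<open>For almost every \<open>\<tau>\<close> the set \<open>slice P \<tau>\<close> is a Hahn set of \<open>\<mu> \<tau>\<close>, so that \<open>\<bar>\<mu> \<tau>\<bar>(B)\<close> is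
\<open>\<mu> \<tau> (B \<inter> slice P \<tau>) - \<mu> \<tau> (B - slice P \<tau>)\<close>. Integrated over \<open>\<tau>\<close> this is the same
expression for \<open>\<nu>\<close>, so \<open>\<bar>\<nu>\<bar>\<close> is the mixture of the \<open>\<bar>\<mu> \<tau>\<bar>\<close>, and the
measurability of \<open>\<tau> \<mapsto> \<bar>\<mu> \<tau>\<bar>(B)\<close> comes for free. The signed integrals follow by
integrating \<open>h\<close>, that is \<open>f\<close> with its sign reversed off \<open>P\<close>.\<close>

theorem signed_fubini:
  assumes f: "signed_integrable (rect_borel T) \<nu> f"
  shows "AE \<tau> in lebesgue_on {0..T}. signed_integrable delay_borel (\<mu> \<tau>) (\<lambda>s. f (\<tau>, s))"
    and "integrable (lebesgue_on {0..T}) (\<lambda>\<tau>. signed_integral delay_borel (\<mu> \<tau>) (\<lambda>s. f (\<tau>, s)))"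
    and "(\<integral>\<tau>. signed_integral delay_borel (\<mu> \<tau>) (\<lambda>s. f (\<tau>, s)) \<partial>lebesgue_on {0..T})
      = signed_integral (rect_borel T) \<nu> f"
proof -
  let ?L = "lebesgue_on {0..T}"
  interpret \<nu>: bounded_signed_measure "rect_borel T" \<nu> "\<integral>\<tau>. C \<partial>?L"
    by (rule bounded_signed_measure_integrated)
  obtain P where P: "hahn_set (rect_borel T) \<nu> P" using \<nu>.hahn_set_exists ..
  interpret \<nu>: hahn_decomposition "rect_borel T" \<nu> "\<integral>\<tau>. C \<partial>?L" P
    using P by unfold_locales
  let ?R = "variation_measure (rect_borel T) \<nu>"
  obtain N where N: "N \<in> null_sets ?L"
    and hahn_N: "\<And>\<tau>. \<tau> \<in> {0..T} - N \<Longrightarrow> hahn_set delay_borel (\<mu> \<tau>) (slice P \<tau>)"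
    using AE_E3[OF AE_hahn_set_slice[OF P]] by (auto simp: space_restrict_space)
  have hahn: "hahn_decomposition delay_borel (\<mu> \<tau>) C (slice P \<tau>)" if "\<tau> \<in> {0..T} - N" for \<tau>
    using that kernel[of \<tau>] hahn_N[of \<tau>]
    by (auto simp: hahn_decomposition_def hahn_decomposition_axioms_def)
  \<comment> \<open>On the exceptional null set the kernel is set to the zero measure: there the formula for the
    variation through \<open>slice P \<tau>\<close>, which gives measurability in \<open>\<tau>\<close>, may fail.\<close>
  define \<kappa> where "\<kappa> \<tau> = (if \<tau> \<in> {0..T} - N
    then distr (variation_measure delay_borel (\<mu> \<tau>)) (rect_borel T) (Pair \<tau>)
    else null_measure (rect_borel T))" for \<tau>
  have AE_good: "AE \<tau> in ?L. \<tau> \<in> {0..T} - N"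
    using AE_not_in[OF N] AE_space by eventually_elim (simp add: space_restrict_space)
  have Pair: "Pair \<tau> \<in> variation_measure delay_borel (\<mu> \<tau>) \<rightarrow>\<^sub>M rect_borel T"
    if "\<tau> \<in> {0..T} - N" for \<tau>
    using that measurable_Pair_rect_borel[of \<tau> T]
    by (simp add: measurable_cong_sets[OF hahn_decomposition.sets_variation_measure[OF hahn[OF that]] refl])
  have emeasure_\<kappa>: "emeasure (\<kappa> \<tau>) A = ennreal (\<mu> \<tau> (slice (A \<inter> P) \<tau>) - \<mu> \<tau> (slice (A - P) \<tau>))"
    if A: "A \<in> sets (rect_borel T)" and \<tau>: "\<tau> \<in> {0..T} - N" for A \<tau>
  proof -
    interpret hahn_decomposition delay_borel "\<mu> \<tau>" C "slice P \<tau>" using \<tau> by (rule hahn)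
    have "Pair \<tau> -` A \<inter> space delay_borel = slice A \<tau>"
      by (auto simp: slice_def space_restrict_space)
    moreover have "slice A \<tau> \<in> sets delay_borel"
      using A unfolding sets_rect_borel_iff by (intro slice_sets) simp
    ultimately show ?thesis
      unfolding \<kappa>_def if_P[OF \<tau>] emeasure_distr[OF Pair[OF \<tau>] A] space_variation_measure
      by (simp only: emeasure_variation_measure slice_simps)
  qed
  interpret mix: measure_mixture ?L ?R \<kappa>
  proof
    show "sets (\<kappa> \<tau>) = sets ?R" for \<tau> by (simp add: \<kappa>_def)
    fix A assume "A \<in> sets ?R"
    then have A: "A \<in> sets (rect_borel T)" by simp
    then have A': "A \<inter> P \<in> sets borel" "A - P \<in> sets borel"
      using \<nu>.P unfolding sets_rect_borel_iff by auto
    define g where "g \<tau> = \<mu> \<tau> (slice (A \<inter> P) \<tau>) - \<mu> \<tau> (slice (A - P) \<tau>)" for \<tau>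
    have g: "g \<in> borel_measurable ?L" "integrable ?L g"
      unfolding g_def[abs_def] using A' measurable_slice integrable_slice
      by (simp_all add: borel_measurable_diff)
    have eq: "emeasure (\<kappa> \<tau>) A = ennreal (indicator ({0..T} - N) \<tau> * g \<tau>)" for \<tau>
    proof (cases "\<tau> \<in> {0..T} - N")
      case True
      then show ?thesis using emeasure_\<kappa>[OF A True] by (simp add: g_def)
    next
      case False
      then have "\<kappa> \<tau> = null_measure (rect_borel T)" unfolding \<kappa>_def by (rule if_not_P)
      moreover have "indicator ({0..T} - N) \<tau> = (0 :: real)"
        using False by (rule indicator_simps(2))
      ultimately show ?thesis by (simp only: emeasure_null_measure mult_zero_left ennreal_0)
    qed
    have sets: "{0..T} - N \<in> sets ?L"
      using sets.compl_sets[OF null_setsD2[OF N]] by (simp add: space_restrict_space)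
    show "(\<lambda>\<tau>. emeasure (\<kappa> \<tau>) A) \<in> borel_measurable ?L"
      unfolding eq using g(1) sets by measurable
    have "0 \<le> g \<tau>" if "\<tau> \<in> {0..T} - N" for \<tau>
    proof -
      interpret hahn_decomposition delay_borel "\<mu> \<tau>" C "slice P \<tau>" using that by (rule hahn)
      have "slice A \<tau> \<in> sets delay_borel"
        using A unfolding sets_rect_borel_iff by (intro slice_sets) simp
      then show ?thesis
        using pos_nonneg[of "slice A \<tau>"] neg_nonneg[of "slice A \<tau>"]
        by (simp add: g_def slice_simps pos_def neg_def)
    qed
    with AE_good have nn: "AE \<tau> in ?L. 0 \<le> g \<tau>" by (rule eventually_mono)
    have "(\<integral>\<^sup>+\<tau>. emeasure (\<kappa> \<tau>) A \<partial>?L) = (\<integral>\<^sup>+\<tau>. ennreal (g \<tau>) \<partial>?L)"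
    proof (rule nn_integral_cong_AE)
      show "AE \<tau> in ?L. emeasure (\<kappa> \<tau>) A = ennreal (g \<tau>)"
        using AE_good by eventually_elim (simp add: eq)
    qed
    also have "\<dots> = ennreal (\<integral>\<tau>. g \<tau> \<partial>?L)"
      using g nn by (intro nn_integral_eq_integral)
    also have "(\<integral>\<tau>. g \<tau> \<partial>?L) = \<nu> (A \<inter> P) - \<nu> (A - P)"
      unfolding g_def \<nu>_eq using A' by (intro Bochner_Integration.integral_diff integrable_slice)
    also have "ennreal \<dots> = emeasure ?R A"
      using A by (simp only: \<nu>.emeasure_variation_measure)
    finally show "emeasure ?R A = (\<integral>\<^sup>+\<tau>. emeasure (\<kappa> \<tau>) A \<partial>?L)" ..
  qed
  define h where "h x = (if x \<in> P then f x else - f x)" for x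
  have f_int: "integrable ?R f" using f by (simp add: signed_integrable_def)
  have f_meas [measurable]: "f \<in> borel_measurable (rect_borel T)"
    using borel_measurable_integrable[OF f_int]
    by (simp add: measurable_cong_sets[OF \<nu>.sets_variation_measure refl])
  have h_meas: "h \<in> borel_measurable (rect_borel T)"
    unfolding h_def[abs_def] using \<nu>.P by measurable
  have h_int: "integrable ?R h"
    using f_int by (rule Bochner_Integration.integrable_bound)
      (simp_all add: measurable_cong_sets[OF \<nu>.sets_variation_measure refl] h_meas, simp add: h_def)
  have slice_integrable: "signed_integrable delay_borel (\<mu> \<tau>) (\<lambda>s. f (\<tau>, s))"
    if "\<tau> \<in> {0..T} - N" "integrable (\<kappa> \<tau>) f" for \<tau>
    using that(2) integrable_distr_eq[OF Pair[OF that(1)] f_meas]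
    unfolding \<kappa>_def if_P[OF that(1)] signed_integrable_def by simp
  have slice_integral: "signed_integral delay_borel (\<mu> \<tau>) (\<lambda>s. f (\<tau>, s)) = (\<integral>x. h x \<partial>\<kappa> \<tau>)"
    if \<tau>: "\<tau> \<in> {0..T} - N" and int: "integrable (\<kappa> \<tau>) f" for \<tau>
  proof -
    interpret hahn_decomposition delay_borel "\<mu> \<tau>" C "slice P \<tau>" using \<tau> by (rule hahn)
    have "signed_integral delay_borel (\<mu> \<tau>) (\<lambda>s. f (\<tau>, s))
        = (\<integral>s. (if s \<in> slice P \<tau> then f (\<tau>, s) else - f (\<tau>, s)) \<partial>variation_measure delay_borel (\<mu> \<tau>))"
      by (rule signed_integral_eq[OF slice_integrable[OF \<tau> int]])
    also have "\<dots> = (\<integral>s. h (\<tau>, s) \<partial>variation_measure delay_borel (\<mu> \<tau>))"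
      by (intro Bochner_Integration.integral_cong refl)
        (auto simp: h_def slice_def space_restrict_space)
    also have "\<dots> = (\<integral>x. h x \<partial>\<kappa> \<tau>)"
      unfolding \<kappa>_def if_P[OF \<tau>] by (rule integral_distr[OF Pair[OF \<tau>] h_meas, symmetric])
    finally show ?thesis .
  qed
  from AE_good mix.integral_mixture(1)[OF f_int]
  show "AE \<tau> in ?L. signed_integrable delay_borel (\<mu> \<tau>) (\<lambda>s. f (\<tau>, s))"
    by eventually_elim (rule slice_integrable)
  from AE_good mix.integral_mixture(1)[OF f_int]
  have AE_eq: "AE \<tau> in ?L. (\<integral>x. h x \<partial>\<kappa> \<tau>) = signed_integral delay_borel (\<mu> \<tau>) (\<lambda>s. f (\<tau>, s))"
    by eventually_elim (rule slice_integral[symmetric])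
  have meas_h: "(\<lambda>\<tau>. \<integral>x. h x \<partial>\<kappa> \<tau>) \<in> borel_measurable ?L"
    using mix.integral_mixture(2)[OF h_int] by (rule borel_measurable_integrable)
  then have meas: "(\<lambda>\<tau>. signed_integral delay_borel (\<mu> \<tau>) (\<lambda>s. f (\<tau>, s))) \<in> borel_measurable ?L"
    using AE_eq by (intro borel_measurable_lebesgue_on_AE[OF _ meas_h AE_eq]) auto
  show "integrable ?L (\<lambda>\<tau>. signed_integral delay_borel (\<mu> \<tau>) (\<lambda>s. f (\<tau>, s)))"
    using integrable_cong_AE[THEN iffD1, OF meas_h meas AE_eq mix.integral_mixture(2)[OF h_int]] .
  have "(\<integral>\<tau>. signed_integral delay_borel (\<mu> \<tau>) (\<lambda>s. f (\<tau>, s)) \<partial>?L) = (\<integral>\<tau>. \<integral>x. h x \<partial>\<kappa> \<tau> \<partial>?L)"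
    by (rule integral_cong_AE[OF meas_h meas AE_eq, symmetric])
  also have "\<dots> = (\<integral>x. h x \<partial>?R)" by (rule mix.integral_mixture(3)[OF h_int])
  also have "\<dots> = signed_integral (rect_borel T) \<nu> f"
    unfolding h_def[abs_def] by (rule \<nu>.signed_integral_eq[OF f, symmetric])
  finally show "(\<integral>\<tau>. signed_integral delay_borel (\<mu> \<tau>) (\<lambda>s. f (\<tau>, s)) \<partial>?L)
      = signed_integral (rect_borel T) \<nu> f" .
qed

end

section \<open>Measurability from continuous test functions\<close>

text \<open>Continuous ramps decrease to the indicator of a half-line, so \<open>\<tau> \<mapsto> \<mu> \<tau> ({-1..0} \<inter> {..x})\<close> is a limit of
measurable functions. The slices of the quadrants \<open>{..(a, x)}\<close> are half-lines or empty, and the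
quadrants generate the Borel sets of the plane and are closed under intersection; Dynkin's theorem
gives measurability for slices of all Borel sets.\<close>

lemma bounded_signed_kernel_if_delay_measure_map:
  assumes K: "0 \<le> K" and \<mu>: "\<mu> \<in> delay_measure_maps T K"
  shows "bounded_signed_kernel T K \<mu>"
proof (rule bounded_signed_kernel.intro)
  have space: "space delay_borel = {-1..0}" by (simp add: space_restrict_space)
  show kernel: "bounded_signed_measure delay_borel (\<mu> \<tau>) K" if "\<tau> \<in> {0..T}" for \<tau>
  proof (rule bounded_signed_measure_if_variation_le)
    have "\<mu> \<tau> \<in> delay_measures K" using \<mu> that by (auto simp: delay_measure_maps_def)
    then show "signed_measure delay_borel (\<mu> \<tau>)"
      "variation delay_borel (\<mu> \<tau>) (space delay_borel) \<le> ennreal K"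
      by (simp_all add: delay_measures_def space)
  qed (rule K)
  let ?L = "lebesgue_on {0..T}"
  have cong: "u \<in> borel_measurable ?L \<longleftrightarrow> v \<in> borel_measurable ?L"
    if "\<And>\<tau>. \<tau> \<in> {0..T} \<Longrightarrow> u \<tau> = v \<tau>" for u v :: "real \<Rightarrow> real"
    using that by (intro measurable_cong) (simp add: space_restrict_space)
  have cdf: "(\<lambda>\<tau>. \<mu> \<tau> ({-1..0} \<inter> {..x})) \<in> borel_measurable ?L" for x
  proof -
    define g where "g n s = max 0 (min 1 (1 - real n * (s - x)))" for n s
    have g_cont: "continuous_on {-1..0} (g n)" for n
      unfolding g_def by (intro continuous_intros)
    have g_lim: "(\<lambda>n. g n s) \<longlonglongrightarrow> indicator ({-1..0} \<inter> {..x}) s" if s: "s \<in> {-1..0}" for s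
    proof (cases "s \<le> x")
      case True
      then have "real n * (s - x) \<le> 0" for n by (simp add: mult_nonneg_nonpos)
      then have "g n s = 1" for n by (simp add: g_def)
      with True s show ?thesis by simp
    next
      case False
      then obtain N :: nat where N: "1 < real N * (s - x)"
        using reals_Archimedean3[of "s - x"] by auto
      have "g n s = 0" if "N \<le> n" for n
      proof -
        have "real N * (s - x) \<le> real n * (s - x)"
          using that False by (intro mult_right_mono) auto
        with N show ?thesis by (simp add: g_def)
      qed
      then have "\<forall>\<^sub>F n in sequentially. g n s = 0" by (auto simp: eventually_sequentially)
      with False show ?thesis by (simp add: tendsto_eventually)
    qed
    show ?thesis
    proof (rule borel_measurable_LIMSEQ_real)
      show "(\<lambda>\<tau>. signed_integral delay_borel (\<mu> \<tau>) (g n)) \<in> borel_measurable ?L" for n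
        using \<mu> g_cont by (simp add: delay_measure_maps_def)
      fix \<tau> assume "\<tau> \<in> space ?L"
      then have \<tau>: "\<tau> \<in> {0..T}" by (simp add: space_restrict_space)
      interpret bounded_signed_measure delay_borel "\<mu> \<tau>" K by (rule kernel[OF \<tau>])
      obtain P where "hahn_set delay_borel (\<mu> \<tau>) P" using hahn_set_exists ..
      then interpret hahn_decomposition delay_borel "\<mu> \<tau>" K P by unfold_locales
      have sets: "{-1..0} \<inter> {..x} \<in> sets delay_borel" by (simp add: sets_delay_borel_iff)
      have "(\<lambda>n. signed_integral delay_borel (\<mu> \<tau>) (g n))
          \<longlonglongrightarrow> signed_integral delay_borel (\<mu> \<tau>) (indicator ({-1..0} \<inter> {..x}))"
      proof (rule signed_integral_tendsto)
        show "g n \<in> borel_measurable delay_borel" for n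
          using g_cont by (rule borel_measurable_continuous_on_restrict)
        show "indicator ({-1..0} \<inter> {..x}) \<in> borel_measurable delay_borel"
          using sets by (rule borel_measurable_indicator)
        show "\<bar>g n s\<bar> \<le> 1" for n s by (simp add: g_def)
        show "(\<lambda>n. g n s) \<longlonglongrightarrow> indicator ({-1..0} \<inter> {..x}) s" if "s \<in> space delay_borel" for s
          using that unfolding space by (rule g_lim)
      qed
      then show "(\<lambda>n. signed_integral delay_borel (\<mu> \<tau>) (g n)) \<longlonglongrightarrow> \<mu> \<tau> ({-1..0} \<inter> {..x})"
        unfolding signed_integral_indicator[OF sets] .
    qed
  qed
  have borel_eq: "sets (borel :: (real \<times> real) measure) = sigma_sets UNIV (range atMost)"
    by (subst borel_eq_atMost) simp
  fix A :: "(real \<times> real) set"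
  assume "A \<in> sets borel"
  then have A: "A \<in> sigma_sets UNIV (range atMost)" unfolding borel_eq .
  have "Int_stable (range (atMost :: real \<times> real \<Rightarrow> _))"
  proof (rule Int_stableI)
    fix B C :: "(real \<times> real) set" assume "B \<in> range atMost" "C \<in> range atMost"
    then obtain p q where "B = {..p}" "C = {..q}" by auto
    then have "B \<inter> C = {..inf p q}" by auto
    then show "B \<inter> C \<in> range atMost" by simp
  qed
  moreover have "range (atMost :: real \<times> real \<Rightarrow> _) \<subseteq> Pow UNIV" by simp
  ultimately show "(\<lambda>\<tau>. \<mu> \<tau> (slice A \<tau>)) \<in> borel_measurable ?L"
    using A
  proof (induction A rule: sigma_sets_induct_disjoint)
    case (basic A)
    then obtain a x where A: "A = {..(a, x)}" by auto
    have "(\<lambda>\<tau>. indicator ({0..T} \<inter> {..a}) \<tau> * \<mu> \<tau> ({-1..0} \<inter> {..x})) \<in> borel_measurable ?L"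
    proof (intro borel_measurable_times borel_measurable_indicator cdf)
      show "{0..T} \<inter> {..a} \<in> sets ?L" by (simp add: sets_restrict_space_iff)
    qed
    moreover have "\<mu> \<tau> (slice A \<tau>) = indicator ({0..T} \<inter> {..a}) \<tau> * \<mu> \<tau> ({-1..0} \<inter> {..x})"
      if "\<tau> \<in> {0..T}" for \<tau>
    proof -
      have "slice A \<tau> = (if \<tau> \<le> a then {-1..0} \<inter> {..x} else {})"
        by (auto simp: slice_def A)
      then show ?thesis using bounded_signed_measure.empty[OF kernel[OF that]] that by simp
    qed
    ultimately show ?case by (rule cong[THEN iffD2, rotated])
  next
    case empty
    have "\<mu> \<tau> (slice {} \<tau>) = 0" if "\<tau> \<in> {0..T}" for \<tau>
      using bounded_signed_measure.empty[OF kernel[OF that]] by (simp add: slice_simps)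
    then show ?case by (rule cong[THEN iffD2, OF _ borel_measurable_const])
  next
    case (compl A)
    have "\<mu> \<tau> (slice (UNIV - A) \<tau>) = \<mu> \<tau> ({-1..0} \<inter> {..0}) - \<mu> \<tau> (slice A \<tau>)"
      if "\<tau> \<in> {0..T}" for \<tau>
    proof -
      have A_borel: "A \<in> sets borel" using compl(1) unfolding borel_eq .
      have eq: "slice (UNIV - A) \<tau> = ({-1..0} \<inter> {..0}) - slice A \<tau>"
        by (auto simp: slice_def)
      have top: "{-1..0} \<inter> {..0} \<in> sets delay_borel" by (simp add: sets_delay_borel_iff)
      have sub: "slice A \<tau> \<subseteq> {-1..0} \<inter> {..0}" by (auto simp: slice_def)
      show ?thesis
        unfolding eq
        by (rule bounded_signed_measure.Diff_subset[OF kernel[OF that] top slice_sets[OF A_borel] sub])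
    qed
    moreover have "(\<lambda>\<tau>. \<mu> \<tau> ({-1..0} \<inter> {..0}) - \<mu> \<tau> (slice A \<tau>)) \<in> borel_measurable ?L"
      using cdf compl(2) by (rule borel_measurable_diff)
    ultimately show ?case by (rule cong[THEN iffD2])
  next
    case (union E)
    show ?case
    proof (rule borel_measurable_LIMSEQ_real)
      show "(\<lambda>\<tau>. \<Sum>i<n. \<mu> \<tau> (slice (E i) \<tau>)) \<in> borel_measurable ?L" for n
        using union by (intro borel_measurable_sum) auto
      fix \<tau> assume "\<tau> \<in> space ?L"
      then have \<tau>: "\<tau> \<in> {0..T}" by (simp add: space_restrict_space)
      have "slice (E i) \<tau> \<in> sets delay_borel" for i
        using union(2) unfolding borel_eq[symmetric] by (intro slice_sets) auto
      moreover have "disjoint_family (\<lambda>i. slice (E i) \<tau>)"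
        using union(1) by (auto simp: disjoint_family_on_def slice_def)
      ultimately have "(\<lambda>i. \<mu> \<tau> (slice (E i) \<tau>)) sums \<mu> \<tau> (\<Union>i. slice (E i) \<tau>)"
        by (rule bounded_signed_measure.sums_UN[OF kernel[OF \<tau>]])
      then show "(\<lambda>n. \<Sum>i<n. \<mu> \<tau> (slice (E i) \<tau>)) \<longlonglongrightarrow> \<mu> \<tau> (slice (\<Union>i. E i) \<tau>)"
        by (simp add: sums_def slice_simps)
    qed
  qed
qed

theorem theorem4p2:
  fixes T K :: real
    and \<mu> :: "real \<Rightarrow> real set \<Rightarrow> real"
    and f :: "real \<times> real \<Rightarrow> real"
  assumes "T > 0" and "K > 0"
    and "\<mu> \<in> delay_measure_maps T K"
    and "signed_integrable (rect_borel T) (integrated_measure T \<mu>) f"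
  shows "(AE \<tau> in lebesgue_on {0..T}. signed_integrable delay_borel (\<mu> \<tau>) (\<lambda>s. f (\<tau>, s)))
    \<and> integrable (lebesgue_on {0..T})
        (\<lambda>\<tau>. signed_integral delay_borel (\<mu> \<tau>) (\<lambda>s. f (\<tau>, s)))
    \<and> integral\<^sup>L (lebesgue_on {0..T})
        (\<lambda>\<tau>. signed_integral delay_borel (\<mu> \<tau>) (\<lambda>s. f (\<tau>, s)))
      = signed_integral (rect_borel T) (integrated_measure T \<mu>) f"
proof -
  interpret bounded_signed_kernel T K \<mu>
    using assms(2,3) by (intro bounded_signed_kernel_if_delay_measure_map) auto
  show ?thesis using signed_fubini[OF assms(4)] by blast
qed

end
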